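(* Assume the system is regular, linearly parametrized, locally exponentially stabilizable by the feedback $\kappa$, and satisfies the setpoint conditions (all as defined in the context). Let $\bar{\mathcal J}>0$, $\omega\ge1$, $M\ge 1$, $N\ge1$ be such that there is $\alpha>0$ with $$\mathcal{J}_{N,\kappa}^\star(f(x,\pi_\kappa(x,\theta),\theta,0),\theta)-\mathcal{J}_{N,\kappa}^\star(x,\theta)\le-\alpha\,\ell(x,\pi_\kappa(x,\theta),x^{\star,\kappa}_{\mathrm{s},x,\theta},u^{\star,\kappa}_{\mathrm{s},x,\theta})$$ for all $(x,\theta)\in\mathbb{X}_{\bar{\mathcal J}}:=\{(x,\theta)\in\mathbb{R}^{n_x}\times\Theta:\mathcal{J}_{N,\kappa}^\star(x,\theta)\le\bar{\mathcal J}\}$. Then there exist constants $\rho_V\in(0,1)$, $c_V>0$ such that for any initial condition with $(\hat x_0,\hat\theta_0)\in\mathbb{X}_{\bar{\mathcal J}}$ and any parameter estimates $\hat\theta_k\in\Theta$, parameters $\theta_k\in\Theta$, noise $v_k\in\mathbb{R}^{n_x}$, disturbances $w_k\in\mathbb{R}^{n_w}$ for which the closed-loop system $x_{k+1}=f(x_k,u_k,\theta_k,w_k)$, $u_k=\pi_\kappa(\hat x_k,\hat\theta_k)$, $\hat x_k=x_k+v_k$ satisfies $$\|\tilde w_k+\tilde x_{1|k}\|^2+\|\hat\theta_{k+1}-\hat\theta_k\|^2\le\frac{\bar{\mathcal J}}{c_V(1-\rho_V)}\quad\text{for all }k\ge0,$$ where $\tilde x_{1|k}=G(\hat x_k,u_k,0)(\theta_k-\hat\theta_k)$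 and $\tilde w_k=\hat x_{k+1}-f(\hat x_k,u_k,\theta_k,0)$, the closed loop satisfies, for all $k\ge0$, $(\hat x_k,\hat\theta_k)\in\mathbb{X}_{\bar{\mathcal J}}$ and $$\mathcal{J}_{N,\kappa}^\star(\hat x_{k+1},\hat\theta_{k+1})\le\rho_V\mathcal{J}_{N,\kappa}^\star(\hat x_k,\hat\theta_k)+c_V\left(\|\tilde w_k+\tilde x_{1|k}\|^2+\|\hat\theta_{k+1}-\hat\theta_k\|^2\right).$$
   Context: Notation: $\|\cdot\|$ is the Euclidean norm, $\|z\|_P=\sqrt{z^\top Pz}$ for $P\succ0$. Data: $f:\mathbb{R}^{n_x}\times\mathbb{R}^{n_u}\times\mathbb{R}^{n_\theta}\times\mathbb{R}^{n_w}\to\mathbb{R}^{n_x}$, $h:\mathbb{R}^{n_x}\times\mathbb{R}^{n_u}\times\mathbb{R}^{n_\theta}\to\mathbb{R}^{n_y}$, compact $\mathbb{U}\subset\mathbb{R}^{n_u}$, compact $\bar{\mathbb{U}}\subseteq\mathrm{int}(\mathbb{U})$, $\Theta\subset\mathbb{R}^{n_\theta}$, $\mathbb{X}=\{x\in\mathbb{R}^{n_x}: D_ix\le d_i,\ i=1,\dots,r\}$, target $y_{\mathrm d}\in\mathbb{R}^{n_y}$, positive definite $Q,R,T$, weights $q_{\xi,i}>0$. Setpoints: $\bar{\mathbb{S}}(\theta)=\{(x,u,y)\in\mathbb{X}\times\bar{\mathbb{U}}\times\mathbb{R}^{n_y}: f(x,u,\theta,0)=x,\ y=h(x,u,\theta)\}$,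 and $(x_{\mathrm{rd},\theta},u_{\mathrm{rd},\theta},y_{\mathrm{rd},\theta})\in\arg\min_{(x,u,y)\in\bar{\mathbb{S}}(\theta)}\|y_{\mathrm d}-y\|_T^2$. Regular: $\bar{\mathbb{S}}(\theta)$ is non-empty, closed and uniformly bounded for $\theta\in\Theta$; $f,h$ are continuously differentiable and Lipschitz continuous with constants $L_f,L_h$ (arguments $x\in\mathbb{R}^{n_x},u\in\mathbb{U},\theta\in\Theta,w\in\mathbb{R}^{n_w}$); $\bar{\mathbb{U}},\Theta$ are convex and compact. Linearly parametrized: $f(x,u,\theta,w)=f(x,u,0,w)+G(x,u,w)\theta$ for a matrix-valued $G$. Setpoint conditions: (i) there are functions $g_{y,x}:\mathbb{R}^{n_y}\times\Theta\to\mathbb{R}^{n_x}$, $g_{y,u}:\mathbb{R}^{n_y}\times\Theta\to\mathbb{R}^{n_u}$ with $x=g_{y,x}(y,\theta)$, $u=g_{y,u}(y,\theta)$ for all $\theta\in\Theta$, $(x,u,y)\in\bar{\mathbb{S}}(\theta)$, and $L_g\ge0$ with $\|g_{y,x}(y,\theta)-g_{y,x}(\tilde y,\tilde\theta)\|_Q^2+\|g_{y,u}(y,\theta)-g_{y,u}(\tilde y,\tilde\theta)\|_R^2\le L_g(\|y-\tilde y\|_T^2+\|\theta-\tilde\theta\|^2)$ for all $y,\tilde y\in\mathbb{R}^{n_y}$, $\theta,\tilde\theta\in\Theta$; (ii) for $\theta\in\Theta$, $(x_1,u_1,y_1),(x_2,u_2,y_2)\in\bar{\mathbb{S}}(\theta)$,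 $\beta\in[0,1]$, $\tilde y=\beta y_1+(1-\beta)y_2$ satisfies $(g_{y,x}(\tilde y,\theta),g_{y,u}(\tilde y,\theta),\tilde y)\in\bar{\mathbb{S}}(\theta)$; (iii) $y_{\mathrm{rd},\theta}=y_{\mathrm d}$ for all $\theta\in\Theta$; (iv) there is $L_s\ge 0$ such that for all $\theta,\tilde\theta\in\Theta$, $(x_s,u_s,y_s)\in\bar{\mathbb{S}}(\theta)$: $\min_{(\tilde x_s,\tilde u_s,\tilde y_s)\in\bar{\mathbb{S}}(\tilde\theta)}\|y_s-\tilde y_s\|_T^2\le L_s\|\theta-\tilde\theta\|^2$. Stage cost: $\ell(x,u,x_s,u_s)=\|x-x_s\|_Q^2+\|u-u_s\|_R^2+\sum_{i=1}^rq_{\xi,i}\max\{D_ix-d_i,0\}^2$. Feedback: $\kappa:\mathbb{R}^{n_x}\times\Theta\times\mathbb{X}\times\mathbb{U}\to\mathbb{U}$ with $\kappa(x_s,\theta,x_s,u_s)=u_s$. For the rollout $z_0=x$, $z_{k+1}=f(z_k,\kappa(z_k,\theta,x_s,u_s),\theta,0)$ put $\ell_\kappa(k,x,\theta,x_s,u_s)=\ell(z_k,\kappa(z_k,\theta,x_s,u_s),x_s,u_s)$. Locally exponentially stabilizable by $\kappa$: $\kappa$ is Lipschitz continuous, and there are $c_{\mathrm{loc}}>0$, $C_\ell\ge1$, $\rho\in(0,1)$ such that $\ell_\kappa(k,x,\theta,x_s,u_s)\le C_\ell\rho^k\|x-x_s\|_Q^2$ for all $k\ge0$, $\theta\in\Theta$,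 $(x_s,u_s,y_s)\in\bar{\mathbb{S}}(\theta)$ and $x$ with $\|x-x_s\|_Q^2\le c_{\mathrm{loc}}$. MPC: for $\mathbf{u}\in\mathbb{U}^N$ let $x_{\mathbf u}(k,x,\theta)$ be the solution after $k$ steps of $z_{k+1}=f(z_k,\mathbf{u}_k,\theta,0)$, $z_0=x$. $V_{f,\kappa}(x,x_s,u_s,\theta)=\sum_{k=0}^{M-1}\ell_\kappa(k,x,\theta,x_s,u_s)$; $\mathcal{J}_{N,\kappa}(x,\theta,\mathbf{u},x_s,u_s)=\sum_{k=0}^{N-1}\ell(x_{\mathbf u}(k,x,\theta),\mathbf{u}_k,x_s,u_s)+\omega V_{f,\kappa}(x_{\mathbf u}(N,x,\theta),x_s,u_s,\theta)$. $\mathcal{J}_{N,\kappa}^\star(x,\theta)$ is the minimum of $\mathcal{J}_{N,\kappa}(x,\theta,\mathbf{u},x_s,u_s)+\|y_s-y_{\mathrm d}\|_T^2$ over $\mathbf{u}\in\mathbb{U}^N$, $(x_s,u_s,y_s)\in\bar{\mathbb{S}}(\theta)$; a minimizer is fixed for every $(x,\theta)$, with setpoint part $(x^{\star,\kappa}_{\mathrm{s},x,\theta},u^{\star,\kappa}_{\mathrm{s},x,\theta},y^{\star,\kappa}_{\mathrm{s},x,\theta})$, and $\pi_\kappa(x,\theta)\in\mathbb{U}$ is the first element of its input sequence. *)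

theory Defs
  imports "HOL-Analysis.Analysis"
begin

definition pos_def :: "real^'n^'n \<Rightarrow> bool" where
  "pos_def P \<longleftrightarrow> transpose P = P \<and> (\<forall>z. z \<noteq> 0 \<longrightarrow> z \<bullet> (P *v z) > 0)"

definition wnorm :: "real^'n^'n \<Rightarrow> real^'n \<Rightarrow> real" where
  "wnorm P z = sqrt (z \<bullet> (P *v z))"

definition continuously_differentiable ::
  "('a::real_normed_vector \<Rightarrow> 'b::real_normed_vector) \<Rightarrow> bool" where
  "continuously_differentiable g \<longleftrightarrow>
     (\<exists>g'. (\<forall>z. (g has_derivative blinfun_apply (g' z)) (at z)) \<and> continuous_on UNIV g')"

text \<open>
  The data of the control problem and of the MPC scheme. In the usual notation the fields are, in
  this order: the system maps \<open>f\<close>, \<open>h\<close>; the sets \<open>U\<close>, \<open>Ubar\<close> (inputs admitted for setpoints), \<open>\<Theta>\<close>; the number \<open>r\<close>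
  and the data \<open>D\<^sub>i\<close>, \<open>d\<^sub>i\<close> of the state constraints; the target \<open>y\<^sub>d\<close>; the weights \<open>Q\<close>, \<open>R\<close>, \<open>T\<close>, \<open>q\<^sub>i\<close>;
  the feedback \<open>\<kappa>\<close>; \<open>\<omega>\<close>, \<open>M\<close>, \<open>N\<close>. Each \<open>D\<^sub>i\<close> is a row vector; only the indices \<open>1, \<dots>, r\<close> are used.
\<close>

record ('nx::finite, 'nu::finite, 'np::finite, 'nw::finite, 'ny::finite) mpc =
  dyn :: "real^'nx \<Rightarrow> real^'nu \<Rightarrow> real^'np \<Rightarrow> real^'nw \<Rightarrow> real^'nx"
  outp :: "real^'nx \<Rightarrow> real^'nu \<Rightarrow> real^'np \<Rightarrow> real^'ny"
  inputs :: "(real^'nu) set"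
  sp_inputs :: "(real^'nu) set"
  params :: "(real^'np) set"
  ncon :: nat
  con :: "nat \<Rightarrow> real^'nx"
  bnd :: "nat \<Rightarrow> real"
  target :: "real^'ny"
  wQ :: "real^'nx^'nx"
  wR :: "real^'nu^'nu"
  wT :: "real^'ny^'ny"
  wxi :: "nat \<Rightarrow> real"
  feedback :: "real^'nx \<Rightarrow> real^'np \<Rightarrow> real^'nx \<Rightarrow> real^'nu \<Rightarrow> real^'nu"
  term_weight :: real
  term_steps :: nat
  horizon :: nat

definition states :: "('nx::finite, 'nu::finite, 'np::finite, 'nw::finite, 'ny::finite) mpc
    \<Rightarrow> (real^'nx) set" where
  "states P = {x. \<forall>i\<in>{1..ncon P}. con P i \<bullet> x \<le> bnd P i}"

definition well_posed ::
  "('nx::finite, 'nu::finite, 'np::finite, 'nw::finite, 'ny::finite) mpc \<Rightarrow> bool" where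
  "well_posed P \<longleftrightarrow>
     compact (inputs P) \<and> compact (sp_inputs P) \<and> sp_inputs P \<subseteq> interior (inputs P) \<and>
     pos_def (wQ P) \<and> pos_def (wR P) \<and> pos_def (wT P) \<and>
     (\<forall>i\<in>{1..ncon P}. wxi P i > 0) \<and>
     (\<forall>x. \<forall>\<theta>\<in>params P. \<forall>xs\<in>states P. \<forall>us\<in>inputs P. feedback P x \<theta> xs us \<in> inputs P) \<and>
     (\<forall>\<theta>\<in>params P. \<forall>xs\<in>states P. \<forall>us\<in>inputs P. feedback P xs \<theta> xs us = us)"

definition setpoints :: "('nx::finite, 'nu::finite, 'np::finite, 'nw::finite, 'ny::finite) mpc
    \<Rightarrow> real^'np \<Rightarrow> ((real^'nx) \<times> (real^'nu) \<times> (real^'ny)) set" where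
  "setpoints P \<theta> = {(x, u, y). x \<in> states P \<and> u \<in> sp_inputs P \<and>
                       dyn P x u \<theta> 0 = x \<and> y = outp P x u \<theta>}"

definition optimal_setpoint :: "('nx::finite, 'nu::finite, 'np::finite, 'nw::finite, 'ny::finite) mpc
    \<Rightarrow> (real^'np \<Rightarrow> (real^'nx) \<times> (real^'nu) \<times> (real^'ny)) \<Rightarrow> bool" where
  "optimal_setpoint P rd \<longleftrightarrow>
     (\<forall>\<theta>\<in>params P. is_arg_min (\<lambda>(x, u, y). (wnorm (wT P) (target P - y))\<^sup>2)
                              (\<lambda>s. s \<in> setpoints P \<theta>) (rd \<theta>))"

definition regular ::
  "('nx::finite, 'nu::finite, 'np::finite, 'nw::finite, 'ny::finite) mpc \<Rightarrow> bool" where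
  "regular P \<longleftrightarrow>
     (\<forall>\<theta>\<in>params P. setpoints P \<theta> \<noteq> {} \<and> closed (setpoints P \<theta>)) \<and>
     bounded (\<Union>\<theta>\<in>params P. setpoints P \<theta>) \<and>
     continuously_differentiable (\<lambda>(x, u, \<theta>, w). dyn P x u \<theta> w) \<and>
     continuously_differentiable (\<lambda>(x, u, \<theta>). outp P x u \<theta>) \<and>
     (\<exists>Lf. Lf-lipschitz_on (UNIV \<times> inputs P \<times> params P \<times> UNIV) (\<lambda>(x, u, \<theta>, w). dyn P x u \<theta> w)) \<and>
     (\<exists>Lh. Lh-lipschitz_on (UNIV \<times> inputs P \<times> params P) (\<lambda>(x, u, \<theta>). outp P x u \<theta>)) \<and>
     convex (sp_inputs P) \<and> compact (sp_inputs P) \<and> convex (params P) \<and> compact (params P)"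

definition linearly_parametrized ::
  "('nx::finite, 'nu::finite, 'np::finite, 'nw::finite, 'ny::finite) mpc
    \<Rightarrow> (real^'nx \<Rightarrow> real^'nu \<Rightarrow> real^'nw \<Rightarrow> real^'np^'nx) \<Rightarrow> bool" where
  "linearly_parametrized P G \<longleftrightarrow>
     (\<forall>x u \<theta> w. dyn P x u \<theta> w = dyn P x u 0 w + G x u w *v \<theta>)"

definition setpoint_conditions ::
  "('nx::finite, 'nu::finite, 'np::finite, 'nw::finite, 'ny::finite) mpc
    \<Rightarrow> (real^'np \<Rightarrow> (real^'nx) \<times> (real^'nu) \<times> (real^'ny)) \<Rightarrow> bool" where
  "setpoint_conditions P rd \<longleftrightarrow>
     (\<exists>gx gu.
        (\<forall>\<theta>\<in>params P. \<forall>(x, u, y)\<in>setpoints P \<theta>. x = gx y \<theta> \<and> u = gu y \<theta>) \<and>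
        (\<exists>Lg\<ge>0. \<forall>y y'. \<forall>\<theta>\<in>params P. \<forall>\<theta>'\<in>params P.
           (wnorm (wQ P) (gx y \<theta> - gx y' \<theta>'))\<^sup>2 + (wnorm (wR P) (gu y \<theta> - gu y' \<theta>'))\<^sup>2
             \<le> Lg * ((wnorm (wT P) (y - y'))\<^sup>2 + (norm (\<theta> - \<theta>'))\<^sup>2)) \<and>
        (\<forall>\<theta>\<in>params P. \<forall>(x1, u1, y1)\<in>setpoints P \<theta>. \<forall>(x2, u2, y2)\<in>setpoints P \<theta>. \<forall>\<beta>\<in>{0..1}.
           (let y = \<beta> *\<^sub>R y1 + (1 - \<beta>) *\<^sub>R y2 in (gx y \<theta>, gu y \<theta>, y) \<in> setpoints P \<theta>))) \<and>
     (\<forall>\<theta>\<in>params P. snd (snd (rd \<theta>)) = target P) \<and>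
     (\<exists>Ls\<ge>0. \<forall>\<theta>\<in>params P. \<forall>\<theta>'\<in>params P. \<forall>(xs, us, ys)\<in>setpoints P \<theta>.
        (INF (xs', us', ys')\<in>setpoints P \<theta>'. (wnorm (wT P) (ys - ys'))\<^sup>2)
          \<le> Ls * (norm (\<theta> - \<theta>'))\<^sup>2)"

definition stage_cost :: "('nx::finite, 'nu::finite, 'np::finite, 'nw::finite, 'ny::finite) mpc
    \<Rightarrow> real^'nx \<Rightarrow> real^'nu \<Rightarrow> real^'nx \<Rightarrow> real^'nu \<Rightarrow> real" where
  "stage_cost P x u xs us =
     (wnorm (wQ P) (x - xs))\<^sup>2 + (wnorm (wR P) (u - us))\<^sup>2 +
     (\<Sum>i\<in>{1..ncon P}. wxi P i * (max (con P i \<bullet> x - bnd P i) 0)\<^sup>2)"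

primrec rollout :: "('nx::finite, 'nu::finite, 'np::finite, 'nw::finite, 'ny::finite) mpc
    \<Rightarrow> nat \<Rightarrow> real^'nx \<Rightarrow> real^'np \<Rightarrow> real^'nx \<Rightarrow> real^'nu \<Rightarrow> real^'nx" where
  "rollout P 0 x \<theta> xs us = x"
| "rollout P (Suc k) x \<theta> xs us =
     (let z = rollout P k x \<theta> xs us in dyn P z (feedback P z \<theta> xs us) \<theta> 0)"

definition rollout_cost :: "('nx::finite, 'nu::finite, 'np::finite, 'nw::finite, 'ny::finite) mpc
    \<Rightarrow> nat \<Rightarrow> real^'nx \<Rightarrow> real^'np \<Rightarrow> real^'nx \<Rightarrow> real^'nu \<Rightarrow> real" where
  "rollout_cost P k x \<theta> xs us =
     (let z = rollout P k x \<theta> xs us in stage_cost P z (feedback P z \<theta> xs us) xs us)"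

definition locally_exp_stabilizable ::
  "('nx::finite, 'nu::finite, 'np::finite, 'nw::finite, 'ny::finite) mpc \<Rightarrow> bool" where
  "locally_exp_stabilizable P \<longleftrightarrow>
     (\<exists>L. L-lipschitz_on (UNIV \<times> params P \<times> states P \<times> inputs P)
            (\<lambda>(x, \<theta>, xs, us). feedback P x \<theta> xs us)) \<and>
     (\<exists>cloc>0. \<exists>C\<ge>1. \<exists>\<rho>\<in>{0<..<1}.
        \<forall>k. \<forall>\<theta>\<in>params P. \<forall>(xs, us, ys)\<in>setpoints P \<theta>. \<forall>x.
          (wnorm (wQ P) (x - xs))\<^sup>2 \<le> cloc \<longrightarrow>
          rollout_cost P k x \<theta> xs us \<le> C * \<rho> ^ k * (wnorm (wQ P) (x - xs))\<^sup>2)"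

primrec predicted_state :: "('nx::finite, 'nu::finite, 'np::finite, 'nw::finite, 'ny::finite) mpc
    \<Rightarrow> (nat \<Rightarrow> real^'nu) \<Rightarrow> nat \<Rightarrow> real^'nx \<Rightarrow> real^'np \<Rightarrow> real^'nx" where
  "predicted_state P us 0 x \<theta> = x"
| "predicted_state P us (Suc k) x \<theta> = dyn P (predicted_state P us k x \<theta>) (us k) \<theta> 0"

definition terminal_cost :: "('nx::finite, 'nu::finite, 'np::finite, 'nw::finite, 'ny::finite) mpc
    \<Rightarrow> real^'nx \<Rightarrow> real^'nx \<Rightarrow> real^'nu \<Rightarrow> real^'np \<Rightarrow> real" where
  "terminal_cost P x xs us \<theta> = (\<Sum>k<term_steps P. rollout_cost P k x \<theta> xs us)"

definition tracking_cost :: "('nx::finite, 'nu::finite, 'np::finite, 'nw::finite, 'ny::finite) mpc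
    \<Rightarrow> real^'nx \<Rightarrow> real^'np \<Rightarrow> (nat \<Rightarrow> real^'nu) \<Rightarrow> real^'nx \<Rightarrow> real^'nu \<Rightarrow> real" where
  "tracking_cost P x \<theta> uu xs us =
     (\<Sum>k<horizon P. stage_cost P (predicted_state P uu k x \<theta>) (uu k) xs us) +
     term_weight P * terminal_cost P (predicted_state P uu (horizon P) x \<theta>) xs us \<theta>"

text \<open>An element of \<open>U\<^sup>N\<close> is an extensional function on \<open>{0, \<dots>, N - 1}\<close>.\<close>

definition mpc_feasible :: "('nx::finite, 'nu::finite, 'np::finite, 'nw::finite, 'ny::finite) mpc
    \<Rightarrow> real^'np \<Rightarrow> ((nat \<Rightarrow> real^'nu) \<times> (real^'nx) \<times> (real^'nu) \<times> (real^'ny)) set" where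
  "mpc_feasible P \<theta> = ({..<horizon P} \<rightarrow>\<^sub>E inputs P) \<times> setpoints P \<theta>"

fun mpc_objective :: "('nx::finite, 'nu::finite, 'np::finite, 'nw::finite, 'ny::finite) mpc
    \<Rightarrow> real^'nx \<Rightarrow> real^'np \<Rightarrow> (nat \<Rightarrow> real^'nu) \<times> (real^'nx) \<times> (real^'nu) \<times> (real^'ny) \<Rightarrow> real" where
  "mpc_objective P x \<theta> (uu, xs, us, ys) =
     tracking_cost P x \<theta> uu xs us + (wnorm (wT P) (ys - target P))\<^sup>2"

text \<open>
  The infimum is only meant for \<open>\<theta> \<in> params P\<close>; it is attained there as soon as there is a
  minimizer in the sense of \<open>mpc_minimizer\<close> below.
\<close>

definition mpc_value :: "('nx::finite, 'nu::finite, 'np::finite, 'nw::finite, 'ny::finite) mpc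
    \<Rightarrow> real^'nx \<Rightarrow> real^'np \<Rightarrow> real" where
  "mpc_value P x \<theta> = (INF s\<in>mpc_feasible P \<theta>. mpc_objective P x \<theta> s)"

definition mpc_minimizer :: "('nx::finite, 'nu::finite, 'np::finite, 'nw::finite, 'ny::finite) mpc
    \<Rightarrow> (real^'nx \<Rightarrow> real^'np \<Rightarrow> (nat \<Rightarrow> real^'nu) \<times> (real^'nx) \<times> (real^'nu) \<times> (real^'ny)) \<Rightarrow> bool" where
  "mpc_minimizer P opt \<longleftrightarrow>
     (\<forall>x. \<forall>\<theta>\<in>params P. is_arg_min (mpc_objective P x \<theta>) (\<lambda>s. s \<in> mpc_feasible P \<theta>) (opt x \<theta>))"

definition sublevel :: "('nx::finite, 'nu::finite, 'np::finite, 'nw::finite, 'ny::finite) mpc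
    \<Rightarrow> real \<Rightarrow> ((real^'nx) \<times> (real^'np)) set" where
  "sublevel P Jbar = {(x, \<theta>). \<theta> \<in> params P \<and> mpc_value P x \<theta> \<le> Jbar}"

end

theory Submission
  imports Defs
begin

text \<open>
  Write the next estimate as the nominal successor plus the error \<open>wtilde + xtilde\<close>. On the
  sublevel set the optimal value is bounded by a multiple of the first stage cost, so the descent
  hypothesis makes the nominal step a contraction. All costs are sums of squares of functions that
  are Lipschitz in the data, hence by Young's inequality the error and the parameter update change
  the optimal value by at most a factor \<open>1 + \<epsilon>\<close> and an additive quadratic term. For small \<open>\<epsilon>\<close> the
  contraction survives.
\<close>

text \<open>The stage cost sees only the distance to the optimal artificial setpoint, whereas the
  optimal value also contains the offset cost of that setpoint. A small stage cost with a large
  offset is ruled out by optimality: the target is the output of a setpoint for every parameter, so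
  a bad setpoint could be improved. Since the costs grow quadratically, the optimal value is not
  globally Lipschitz: a change of size \<delta> alters a square by a cross term proportional to
  \<delta> times its root. The factor 1 + \<epsilon> absorbs that cross term and gives an estimate
  valid for all states, with no restriction to a bounded set. A new estimate also changes the set of
  setpoints, so the old setpoint may be lost. Inputs cause no such trouble: the input set does not
  depend on the parameter, and the state constraints enter predicted trajectories only as penalties.
  The constants are fixed in this order: the contraction rate from the descent constant and the cost
  bound, then \<epsilon>, then the gain \<open>K\<close> (which depends on \<epsilon>), and last
  \<open>cV\<close>. None of them depends on the trajectory.\<close>

section \<open>Weighted norms and Young's inequality\<close>

lemma wnorm_power2: "pos_def P \<Longrightarrow> (wnorm P z)\<^sup>2 = z \<bullet> (P *v z)"
  unfolding wnorm_def pos_def_def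
  by (cases "z = 0") (auto intro!: real_sqrt_pow2 less_imp_le)

lemma wnorm_power2_scaleR:
  assumes "pos_def P"
  shows "(wnorm P (c *\<^sub>R z))\<^sup>2 = c\<^sup>2 * (wnorm P z)\<^sup>2"
  unfolding wnorm_power2[OF assms] by (simp add: matrix_vector_mult_scaleR power2_eq_square)

lemma wnorm_power2_minus:
  assumes "pos_def P"
  shows "(wnorm P (x - y))\<^sup>2 = (wnorm P (y - x))\<^sup>2"
  using wnorm_power2_scaleR[OF assms, of "-1" "x - y"] by simp

text \<open>The cross term is controlled by expanding the nonnegative square of
  \<open>e *\<^sub>R a - b\<close> and dividing by \<open>e\<close>. The factor on \<open>a\<close>
  can be brought as close to 1 as desired, at the price of \<open>1 / e\<close> on
  \<open>b\<close>.\<close>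

lemma wnorm_power2_add_le:
  assumes P: "pos_def P" and e: "e > 0"
  shows "(wnorm P (a + b))\<^sup>2 \<le> (1 + e) * (wnorm P a)\<^sup>2 + (1 + 1 / e) * (wnorm P b)\<^sup>2"
proof -
  have sym: "b \<bullet> (P *v a) = a \<bullet> (P *v b)"
    using P unfolding pos_def_def
    by (metis dot_lmul_matrix inner_commute transpose_matrix_vector)
  have "0 \<le> (wnorm P (e *\<^sub>R a - b))\<^sup>2" by simp
  also have "\<dots> = e\<^sup>2 * (a \<bullet> (P *v a)) - 2 * e * (a \<bullet> (P *v b)) + b \<bullet> (P *v b)"
    unfolding wnorm_power2[OF P]
    by (simp add: matrix_vector_mult_diff_distrib matrix_vector_mult_scaleR
        inner_diff_left inner_diff_right sym power2_eq_square algebra_simps)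
  finally have "2 * e * (a \<bullet> (P *v b)) \<le> e\<^sup>2 * (a \<bullet> (P *v a)) + b \<bullet> (P *v b)" by simp
  then have "2 * (a \<bullet> (P *v b)) \<le> e * (a \<bullet> (P *v a)) + (1 / e) * (b \<bullet> (P *v b))"
    using e by (simp add: field_simps power2_eq_square)
  then show ?thesis
    by (simp add: wnorm_power2[OF P] matrix_vector_right_distrib inner_add_left inner_add_right sym
        algebra_simps)
qed

lemma wnorm_power2_le_norm:
  assumes P: "pos_def P"
  shows "\<exists>K\<ge>0. \<forall>z. (wnorm P z)\<^sup>2 \<le> K * (norm z)\<^sup>2"
proof -
  obtain K where K: "\<And>z. norm (P *v z) \<le> norm z * K" "K > 0"
    using bounded_linear.pos_bounded[OF matrix_vector_mul_bounded_linear] by blast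
  have "(wnorm P z)\<^sup>2 \<le> K * (norm z)\<^sup>2" for z
  proof -
    have "(wnorm P z)\<^sup>2 \<le> norm z * norm (P *v z)"
      unfolding wnorm_power2[OF P] by (rule norm_cauchy_schwarz)
    also have "\<dots> \<le> norm z * (norm z * K)" by (intro mult_left_mono K) simp
    finally show ?thesis by (simp add: power2_eq_square mult_ac)
  qed
  with K(2) show ?thesis by (intro exI[of _ K]) auto
qed

text \<open>The quadratic form attains its minimum on the compact unit sphere, and definiteness
  makes that minimum positive. Homogeneity extends the bound to all vectors.\<close>

lemma norm_power2_le_wnorm:
  fixes P :: "real^'n^'n"
  assumes P: "pos_def P"
  shows "\<exists>K\<ge>0. \<forall>z. (norm z)\<^sup>2 \<le> K * (wnorm P z)\<^sup>2"
proof -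
  have "\<exists>z0\<in>sphere (0 :: real^'n) 1. \<forall>z\<in>sphere 0 1. z0 \<bullet> (P *v z0) \<le> z \<bullet> (P *v z)"
    by (intro continuous_attains_inf continuous_intros)
      (auto simp: matrix_vector_mul_linear linear_continuous_on linear_conv_bounded_linear)
  then obtain z0 :: "real^'n" where z0: "norm z0 = 1"
    and min: "\<And>z. norm z = 1 \<Longrightarrow> z0 \<bullet> (P *v z0) \<le> z \<bullet> (P *v z)" by auto
  define m where "m = z0 \<bullet> (P *v z0)"
  have m: "m > 0" using P z0 unfolding m_def pos_def_def by (metis norm_zero zero_neq_one)
  have "(norm z)\<^sup>2 \<le> (1 / m) * (wnorm P z)\<^sup>2" for z
  proof (cases "z = 0")
    case False
    have "m \<le> (wnorm P ((1 / norm z) *\<^sub>R z))\<^sup>2"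
      unfolding m_def wnorm_power2[OF P] by (rule min) (use False in simp)
    also have "\<dots> = (wnorm P z)\<^sup>2 / (norm z)\<^sup>2"
      by (simp add: wnorm_power2_scaleR[OF P] power_divide)
    finally show ?thesis using m False by (simp add: field_simps)
  qed (use m in simp)
  with m show ?thesis by (intro exI[of _ "1 / m"]) auto
qed

lemma power2_add_le_Young:
  fixes a b e :: real
  assumes "e > 0"
  shows "(a + b)\<^sup>2 \<le> (1 + e) * a\<^sup>2 + (1 + 1 / e) * b\<^sup>2"
proof -
  have "0 \<le> (e * a - b)\<^sup>2 / e" using assms by simp
  also have "\<dots> = e * a\<^sup>2 - 2 * a * b + b\<^sup>2 / e"
    using assms by (simp add: power2_eq_square field_simps)
  finally show ?thesis by (simp add: power2_eq_square algebra_simps)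
qed

section \<open>Stage cost: lower bounds and perturbation\<close>

lemma setpointsD:
  assumes "well_posed P" "(xs, us, ys) \<in> setpoints P \<theta>"
  shows "xs \<in> states P" "us \<in> inputs P"
  using assms interior_subset unfolding well_posed_def setpoints_def by blast+

lemma stage_cost_ge:
  assumes "well_posed P"
  shows "(wnorm (wQ P) (x - xs))\<^sup>2 \<le> stage_cost P x u xs us"
proof -
  have "0 \<le> (\<Sum>i\<in>{1..ncon P}. wxi P i * (max (con P i \<bullet> x - bnd P i) 0)\<^sup>2)"
    using assms unfolding well_posed_def by (intro sum_nonneg mult_nonneg_nonneg) (auto intro: less_imp_le)
  then show ?thesis unfolding stage_cost_def by simp
qed

lemma stage_cost_nonneg: "well_posed P \<Longrightarrow> 0 \<le> stage_cost P x u xs us"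
  using stage_cost_ge order_trans zero_le_power2 by blast

text \<open>The new difference is the old one plus a vector of norm at most
  \<open>2 * \<delta>\<close>, to which Young's inequality applies. What matters is the order of
  quantifiers: \<open>K\<close> depends on the matrix and \<open>e\<close> only.\<close>

lemma wnorm_power2_perturb:
  assumes P: "pos_def P" and e: "e > 0"
  shows "\<exists>K\<ge>0. \<forall>a b a' b' \<delta>. norm (a' - a) \<le> \<delta> \<longrightarrow> norm (b' - b) \<le> \<delta> \<longrightarrow>
    (wnorm P (a' - b'))\<^sup>2 \<le> (1 + e) * (wnorm P (a - b))\<^sup>2 + K * \<delta>\<^sup>2"
proof -
  obtain K where K: "K \<ge> 0" "\<And>z. (wnorm P z)\<^sup>2 \<le> K * (norm z)\<^sup>2"
    using wnorm_power2_le_norm[OF P] by blast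
  have "(wnorm P (a' - b'))\<^sup>2 \<le> (1 + e) * (wnorm P (a - b))\<^sup>2 + ((1 + 1 / e) * (K * 4)) * \<delta>\<^sup>2"
    if "norm (a' - a) \<le> \<delta>" "norm (b' - b) \<le> \<delta>" for a b a' b' \<delta>
  proof -
    let ?c = "(a' - a) - (b' - b)"
    have "norm ?c \<le> 2 * \<delta>" using that norm_triangle_ineq4[of "a' - a" "b' - b"] by linarith
    then have "(norm ?c)\<^sup>2 \<le> (2 * \<delta>)\<^sup>2" by (intro power_mono) auto
    then have "(wnorm P ?c)\<^sup>2 \<le> K * (4 * \<delta>\<^sup>2)"
      using K(2)[of ?c] mult_left_mono[OF _ K(1), of "(norm ?c)\<^sup>2" "4 * \<delta>\<^sup>2"] by (simp add: power_mult_distrib)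
    then have "(1 + 1 / e) * (wnorm P ?c)\<^sup>2 \<le> (1 + 1 / e) * (K * (4 * \<delta>\<^sup>2))"
      using e by (intro mult_left_mono) auto
    moreover have "(wnorm P (a' - b'))\<^sup>2 \<le> (1 + e) * (wnorm P (a - b))\<^sup>2 + (1 + 1 / e) * (wnorm P ?c)\<^sup>2"
      using wnorm_power2_add_le[OF P e, of "a - b" ?c] by simp
    moreover have "((1 + 1 / e) * (K * 4)) * \<delta>\<^sup>2 = (1 + 1 / e) * (K * (4 * \<delta>\<^sup>2))" by simp
    ultimately show ?thesis by linarith
  qed
  moreover have "(1 + 1 / e) * (K * 4) \<ge> 0" using K e by simp
  ultimately show ?thesis by (intro exI[of _ "(1 + 1 / e) * (K * 4)"]) blast
qed

text \<open>The positive part is 1-Lipschitz, so the constraint violation grows by at most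
  \<open>norm D * \<delta>\<close>; Young's inequality then handles its square.\<close>

lemma constraint_penalty_perturb:
  fixes D x x' :: "'a::real_inner"
  assumes e: "e > 0" and d: "norm (x' - x) \<le> \<delta>"
  shows "(max (D \<bullet> x' - b) 0)\<^sup>2 \<le> (1 + e) * (max (D \<bullet> x - b) 0)\<^sup>2 + (1 + 1 / e) * (norm D)\<^sup>2 * \<delta>\<^sup>2"
proof -
  have "D \<bullet> x' - D \<bullet> x \<le> norm D * norm (x' - x)"
    using norm_cauchy_schwarz[of D "x' - x"] by (simp add: inner_diff_right)
  also have "\<dots> \<le> norm D * \<delta>" by (intro mult_left_mono d) simp
  finally have "D \<bullet> x' - D \<bullet> x \<le> norm D * \<delta>" .
  moreover have "0 \<le> \<delta>" using d norm_ge_zero order_trans by blast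
  then have "0 \<le> norm D * \<delta>" by simp
  ultimately have "max (D \<bullet> x' - b) 0 \<le> max (D \<bullet> x - b) 0 + norm D * \<delta>" by (auto simp: max_def)
  then have "(max (D \<bullet> x' - b) 0)\<^sup>2 \<le> (max (D \<bullet> x - b) 0 + norm D * \<delta>)\<^sup>2" by (intro power_mono) auto
  also have "\<dots> \<le> (1 + e) * (max (D \<bullet> x - b) 0)\<^sup>2 + (1 + 1 / e) * (norm D * \<delta>)\<^sup>2"
    by (rule power2_add_le_Young[OF e])
  finally show ?thesis by (simp add: power_mult_distrib mult_ac)
qed

text \<open>All three kinds of terms receive the same factor \<open>1 + e\<close>, which therefore
  passes through the weighted sum; only the additive constants accumulate.\<close>

lemma stage_cost_perturb:
  fixes P :: "('nx::finite, 'nu::finite, 'np::finite, 'nw::finite, 'ny::finite) mpc"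
  assumes wp: "well_posed P" and e: "e > 0"
  obtains K where "K \<ge> 0"
    and "\<And>x u xs us x' u' xs' us' \<delta>. \<lbrakk>norm (x' - x) \<le> \<delta>; norm (u' - u) \<le> \<delta>;
      norm (xs' - xs) \<le> \<delta>; norm (us' - us) \<le> \<delta>\<rbrakk> \<Longrightarrow>
      stage_cost P x' u' xs' us' \<le> (1 + e) * stage_cost P x u xs us + K * \<delta>\<^sup>2"
proof -
  have Q: "pos_def (wQ P)" and R: "pos_def (wR P)" and q: "\<And>i. i \<in> {1..ncon P} \<Longrightarrow> wxi P i > 0"
    using wp unfolding well_posed_def by auto
  obtain KQ where KQ: "KQ \<ge> 0" "\<And>a b a' b' \<delta>. norm (a' - a) \<le> \<delta> \<Longrightarrow> norm (b' - b) \<le> \<delta> \<Longrightarrow>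
    (wnorm (wQ P) (a' - b'))\<^sup>2 \<le> (1 + e) * (wnorm (wQ P) (a - b))\<^sup>2 + KQ * \<delta>\<^sup>2"
    using wnorm_power2_perturb[OF Q e] by blast
  obtain KR where KR: "KR \<ge> 0" "\<And>a b a' b' \<delta>. norm (a' - a) \<le> \<delta> \<Longrightarrow> norm (b' - b) \<le> \<delta> \<Longrightarrow>
    (wnorm (wR P) (a' - b'))\<^sup>2 \<le> (1 + e) * (wnorm (wR P) (a - b))\<^sup>2 + KR * \<delta>\<^sup>2"
    using wnorm_power2_perturb[OF R e] by blast
  define KX where "KX = (\<Sum>i\<in>{1..ncon P}. wxi P i * ((1 + 1 / e) * (norm (con P i))\<^sup>2))"
  have KX: "KX \<ge> 0" unfolding KX_def using q e
    by (intro sum_nonneg mult_nonneg_nonneg) (auto intro: less_imp_le)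
  have "stage_cost P x' u' xs' us' \<le> (1 + e) * stage_cost P x u xs us + (KQ + KR + KX) * \<delta>\<^sup>2"
    if d: "norm (x' - x) \<le> \<delta>" "norm (u' - u) \<le> \<delta>" "norm (xs' - xs) \<le> \<delta>" "norm (us' - us) \<le> \<delta>"
    for x u xs us x' u' xs' us' \<delta>
  proof -
    have "(\<Sum>i\<in>{1..ncon P}. wxi P i * (max (con P i \<bullet> x' - bnd P i) 0)\<^sup>2)
      \<le> (\<Sum>i\<in>{1..ncon P}. wxi P i * ((1 + e) * (max (con P i \<bullet> x - bnd P i) 0)\<^sup>2
            + (1 + 1 / e) * (norm (con P i))\<^sup>2 * \<delta>\<^sup>2))"
      using q by (intro sum_mono mult_left_mono constraint_penalty_perturb[OF e d(1)])
        (auto intro: less_imp_le)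
    also have "\<dots> = (1 + e) * (\<Sum>i\<in>{1..ncon P}. wxi P i * (max (con P i \<bullet> x - bnd P i) 0)\<^sup>2) + KX * \<delta>\<^sup>2"
      unfolding KX_def by (simp add: sum_distrib_left sum_distrib_right sum.distrib algebra_simps)
    finally show ?thesis
      using KQ(2)[OF d(1,3)] KR(2)[OF d(2,4)] unfolding stage_cost_def by (simp add: algebra_simps)
  qed
  moreover have "KQ + KR + KX \<ge> 0" using KQ KR KX by simp
  ultimately show thesis using that by blast
qed

section \<open>Trajectories and tracking cost under changes of state, parameter and setpoint\<close>

text \<open>The Lipschitz condition covers all states but only admissible inputs and parameters.
  Predicted states may thus be arbitrary, while feedback values have to be shown to lie in the input
  set.\<close>

lemma dyn_lipschitz:
  fixes P :: "('nx::finite, 'nu::finite, 'np::finite, 'nw::finite, 'ny::finite) mpc"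
  assumes "regular P"
  obtains L where "L \<ge> 0"
    and "\<And>x x' u u' \<theta> \<theta>'. \<lbrakk>u \<in> inputs P; u' \<in> inputs P; \<theta> \<in> params P; \<theta>' \<in> params P\<rbrakk> \<Longrightarrow>
      norm (dyn P x' u' \<theta>' 0 - dyn P x u \<theta> 0) \<le> L * (norm (x' - x) + norm (u' - u) + norm (\<theta>' - \<theta>))"
proof -
  obtain L where L: "L-lipschitz_on (UNIV \<times> inputs P \<times> params P \<times> UNIV) (\<lambda>(x, u, \<theta>, w). dyn P x u \<theta> w)"
    using assms unfolding regular_def by blast
  have L0: "L \<ge> 0" using L by (rule lipschitz_on_nonneg)
  have "norm (dyn P x' u' \<theta>' 0 - dyn P x u \<theta> 0) \<le> L * (norm (x' - x) + norm (u' - u) + norm (\<theta>' - \<theta>))"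
    if "u \<in> inputs P" "u' \<in> inputs P" "\<theta> \<in> params P" "\<theta>' \<in> params P" for x x' u u' \<theta> \<theta>'
  proof -
    have "norm (dyn P x' u' \<theta>' 0 - dyn P x u \<theta> 0)
        \<le> L * norm (x' - x, u' - u, \<theta>' - \<theta>, 0 :: real^'nw)"
      using lipschitz_onD[OF L, of "(x', u', \<theta>', 0)" "(x, u, \<theta>, 0)"] that
      by (simp add: dist_norm)
    also have "norm (x' - x, u' - u, \<theta>' - \<theta>, 0 :: real^'nw) \<le> norm (x' - x) + norm (u' - u) + norm (\<theta>' - \<theta>)"
      using norm_Pair_le[of "x' - x" "(u' - u, \<theta>' - \<theta>, 0 :: real^'nw)"]
        norm_Pair_le[of "u' - u" "(\<theta>' - \<theta>, 0 :: real^'nw)"] norm_Pair_le[of "\<theta>' - \<theta>" "0 :: real^'nw"]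
      by simp
    finally show ?thesis using L0 by (simp add: mult_left_mono)
  qed
  with L0 show thesis by (rule that)
qed

lemma feedback_lipschitz:
  fixes P :: "('nx::finite, 'nu::finite, 'np::finite, 'nw::finite, 'ny::finite) mpc"
  assumes "locally_exp_stabilizable P"
  obtains L where "L \<ge> 0"
    and "\<And>x x' \<theta> \<theta>' xs xs' us us'. \<lbrakk>\<theta> \<in> params P; \<theta>' \<in> params P;
      xs \<in> states P; xs' \<in> states P; us \<in> inputs P; us' \<in> inputs P\<rbrakk> \<Longrightarrow>
      norm (feedback P x' \<theta>' xs' us' - feedback P x \<theta> xs us)
      \<le> L * (norm (x' - x) + norm (\<theta>' - \<theta>) + norm (xs' - xs) + norm (us' - us))"
proof -
  obtain L where L: "L-lipschitz_on (UNIV \<times> params P \<times> states P \<times> inputs P)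
            (\<lambda>(x, \<theta>, xs, us). feedback P x \<theta> xs us)"
    using assms unfolding locally_exp_stabilizable_def by blast
  have L0: "L \<ge> 0" using L by (rule lipschitz_on_nonneg)
  have "norm (feedback P x' \<theta>' xs' us' - feedback P x \<theta> xs us)
      \<le> L * (norm (x' - x) + norm (\<theta>' - \<theta>) + norm (xs' - xs) + norm (us' - us))"
    if "\<theta> \<in> params P" "\<theta>' \<in> params P" "xs \<in> states P" "xs' \<in> states P" "us \<in> inputs P" "us' \<in> inputs P"
    for x x' \<theta> \<theta>' xs xs' us us'
  proof -
    have "norm (feedback P x' \<theta>' xs' us' - feedback P x \<theta> xs us)
        \<le> L * norm (x' - x, \<theta>' - \<theta>, xs' - xs, us' - us)"
      using lipschitz_onD[OF L, of "(x', \<theta>', xs', us')" "(x, \<theta>, xs, us)"] that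
      by (simp add: dist_norm)
    also have "norm (x' - x, \<theta>' - \<theta>, xs' - xs, us' - us)
        \<le> norm (x' - x) + norm (\<theta>' - \<theta>) + norm (xs' - xs) + norm (us' - us)"
      using norm_Pair_le[of "x' - x" "(\<theta>' - \<theta>, xs' - xs, us' - us)"]
        norm_Pair_le[of "\<theta>' - \<theta>" "(xs' - xs, us' - us)"] norm_Pair_le[of "xs' - xs" "us' - us"]
      by simp
    finally show ?thesis using L0 by (simp add: mult_left_mono)
  qed
  with L0 show thesis by (rule that)
qed

lemma feedback_in_inputs:
  "well_posed P \<Longrightarrow> \<theta> \<in> params P \<Longrightarrow> xs \<in> states P \<Longrightarrow> us \<in> inputs P \<Longrightarrow>
    feedback P x \<theta> xs us \<in> inputs P"
  unfolding well_posed_def by blast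

lemma predicted_state_perturb:
  fixes P :: "('nx::finite, 'nu::finite, 'np::finite, 'nw::finite, 'ny::finite) mpc"
  assumes "regular P"
  obtains B where "B \<ge> 1"
    and "\<And>k x x' \<delta> \<theta> \<theta>' uu. \<lbrakk>k \<le> n; \<theta> \<in> params P; \<theta>' \<in> params P;
      uu \<in> {..<n} \<rightarrow>\<^sub>E inputs P; norm (x' - x) \<le> \<delta>; norm (\<theta>' - \<theta>) \<le> \<delta>\<rbrakk> \<Longrightarrow>
      norm (predicted_state P uu k x' \<theta>' - predicted_state P uu k x \<theta>) \<le> B * \<delta>"
proof -
  obtain L where L0: "L \<ge> 0" and L: "\<And>x x' u u' \<theta> \<theta>'. \<lbrakk>u \<in> inputs P; u' \<in> inputs P; \<theta> \<in> params P; \<theta>' \<in> params P\<rbrakk> \<Longrightarrow>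
    norm (dyn P x' u' \<theta>' 0 - dyn P x u \<theta> 0) \<le> L * (norm (x' - x) + norm (u' - u) + norm (\<theta>' - \<theta>))"
    using that by (rule dyn_lipschitz[OF assms])
  \<comment> \<open>The parameter error enters anew at each step. As \<open>A\<close> is at least 1,
    it is at most \<open>A ^ k * \<delta>\<close>, so it doubles the inherited state error at worst;
    this explains the 2. The same inequality lets \<open>A ^ n\<close> serve for all
    \<open>k \<le> n\<close>.\<close>
  define A where "A = 1 + 2 * L"
  have A: "A \<ge> 1" using L0 by (simp add: A_def)
  have step: "norm (predicted_state P uu k x' \<theta>' - predicted_state P uu k x \<theta>) \<le> A ^ k * \<delta>"
    if k: "k \<le> n" and *: "norm (x' - x) \<le> \<delta>" "norm (\<theta>' - \<theta>) \<le> \<delta>" "\<theta> \<in> params P" "\<theta>' \<in> params P"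
      "uu \<in> {..<n} \<rightarrow>\<^sub>E inputs P" for x x' \<delta> \<theta> \<theta>' uu k
    using k
  proof (induction k)
    case 0
    then show ?case using * by simp
  next
    case (Suc k)
    let ?z = "predicted_state P uu k x \<theta>" and ?z' = "predicted_state P uu k x' \<theta>'"
    have u: "uu k \<in> inputs P" using * Suc.prems by (auto simp: PiE_def Pi_def)
    have d: "0 \<le> \<delta>" using * norm_ge_zero order_trans by blast
    have "norm (?z' - ?z) + norm (uu k - uu k) + norm (\<theta>' - \<theta>) \<le> A ^ k * \<delta> + \<delta>"
      using Suc * by simp
    also have "\<dots> \<le> 2 * (A ^ k * \<delta>)" using mult_right_mono[OF one_le_power[OF A, of k] d] by linarith
    finally have "L * (norm (?z' - ?z) + norm (uu k - uu k) + norm (\<theta>' - \<theta>)) \<le> L * (2 * (A ^ k * \<delta>))"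
      by (intro mult_left_mono L0)
    also have "\<dots> \<le> A ^ Suc k * \<delta>"
      using A d by (simp add: A_def algebra_simps)
    finally show ?case
      using L[OF u u *(3,4), of ?z' ?z] by (simp only: predicted_state.simps)
  qed
  have "norm (predicted_state P uu k x' \<theta>' - predicted_state P uu k x \<theta>) \<le> A ^ n * \<delta>"
    if k: "k \<le> n" and *: "\<theta> \<in> params P" "\<theta>' \<in> params P" "uu \<in> {..<n} \<rightarrow>\<^sub>E inputs P"
      "norm (x' - x) \<le> \<delta>" "norm (\<theta>' - \<theta>) \<le> \<delta>" for k x x' \<delta> \<theta> \<theta>' uu
  proof -
    have "0 \<le> \<delta>" using * norm_ge_zero order_trans by blast
    then have "A ^ k * \<delta> \<le> A ^ n * \<delta>" using power_increasing[OF k A] by (intro mult_right_mono)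
    then show ?thesis using step[OF k *(4,5,1,2,3)] by linarith
  qed
  with one_le_power[OF A] show thesis by (rule that)
qed

text \<open>Unlike in an open-loop prediction, the two trajectories here receive different inputs,
  so the error also feeds back through \<open>feedback\<close>. The inputs are bounded along with
  the states because the stage cost charges both.\<close>

lemma rollout_perturb:
  fixes P :: "('nx::finite, 'nu::finite, 'np::finite, 'nw::finite, 'ny::finite) mpc"
  assumes wp: "well_posed P" and "regular P" "locally_exp_stabilizable P"
  obtains B where "B \<ge> 1"
    and "\<And>k x x' \<delta> \<theta> \<theta>' xs xs' us us'. \<lbrakk>k \<le> n; \<theta> \<in> params P; \<theta>' \<in> params P;
      xs \<in> states P; xs' \<in> states P; us \<in> inputs P; us' \<in> inputs P; norm (x' - x) \<le> \<delta>;
      norm (\<theta>' - \<theta>) \<le> \<delta>; norm (xs' - xs) \<le> \<delta>; norm (us' - us) \<le> \<delta>\<rbrakk> \<Longrightarrow>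
    norm (rollout P k x' \<theta>' xs' us' - rollout P k x \<theta> xs us) \<le> B * \<delta> \<and>
    norm (feedback P (rollout P k x' \<theta>' xs' us') \<theta>' xs' us'
      - feedback P (rollout P k x \<theta> xs us) \<theta> xs us) \<le> B * \<delta>"
proof -
  obtain L where L0: "L \<ge> 0" and L: "\<And>x x' u u' \<theta> \<theta>'. \<lbrakk>u \<in> inputs P; u' \<in> inputs P; \<theta> \<in> params P; \<theta>' \<in> params P\<rbrakk> \<Longrightarrow>
    norm (dyn P x' u' \<theta>' 0 - dyn P x u \<theta> 0) \<le> L * (norm (x' - x) + norm (u' - u) + norm (\<theta>' - \<theta>))"
    using that by (rule dyn_lipschitz[OF assms(2)])
  obtain F where F0: "F \<ge> 0" and F: "\<And>x x' \<theta> \<theta>' xs xs' us us'. \<lbrakk>\<theta> \<in> params P; \<theta>' \<in> params P;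
      xs \<in> states P; xs' \<in> states P; us \<in> inputs P; us' \<in> inputs P\<rbrakk> \<Longrightarrow>
    norm (feedback P x' \<theta>' xs' us' - feedback P x \<theta> xs us)
      \<le> F * (norm (x' - x) + norm (\<theta>' - \<theta>) + norm (xs' - xs) + norm (us' - us))"
    using that by (rule feedback_lipschitz[OF assms(3)])
  \<comment> \<open>One unit each for the state and parameter errors, and \<open>4 * F\<close> for
    the input error: the feedback has four arguments, each off by at most
    \<open>A ^ k * \<delta>\<close>.\<close>
  define A where "A = 1 + L * (2 + 4 * F)"
  have A: "A \<ge> 1" using L0 F0 by (simp add: A_def)
  have fb: "norm (feedback P z' \<theta>' xs' us' - feedback P z \<theta> xs us) \<le> 4 * F * (c * \<delta>)"
    if "norm (z' - z) \<le> c * \<delta>" "c \<ge> 1" "norm (\<theta>' - \<theta>) \<le> \<delta>" "norm (xs' - xs) \<le> \<delta>" "norm (us' - us) \<le> \<delta>"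
      "\<theta> \<in> params P" "\<theta>' \<in> params P" "xs \<in> states P" "xs' \<in> states P" "us \<in> inputs P" "us' \<in> inputs P"
    for z z' \<theta> \<theta>' xs xs' us us' \<delta> c
  proof -
    have "0 \<le> \<delta>" using that norm_ge_zero order_trans by blast
    then have "\<delta> \<le> c * \<delta>" using mult_right_mono[of 1 c \<delta>] that by simp
    then have "norm (z' - z) + norm (\<theta>' - \<theta>) + norm (xs' - xs) + norm (us' - us) \<le> 4 * (c * \<delta>)"
      using that by linarith
    from mult_left_mono[OF this F0] show ?thesis using F[OF that(6-11), of z' z] by simp
  qed
  have step: "norm (rollout P k x' \<theta>' xs' us' - rollout P k x \<theta> xs us) \<le> A ^ k * \<delta>"
    if x: "norm (x' - x) \<le> \<delta>" and *: "norm (\<theta>' - \<theta>) \<le> \<delta>" "norm (xs' - xs) \<le> \<delta>" "norm (us' - us) \<le> \<delta>"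
      "\<theta> \<in> params P" "\<theta>' \<in> params P" "xs \<in> states P" "xs' \<in> states P" "us \<in> inputs P" "us' \<in> inputs P"
    for x x' \<theta> \<theta>' xs xs' us us' \<delta> k
  proof (induction k)
    case 0
    then show ?case using x by simp
  next
    case (Suc k)
    let ?z = "rollout P k x \<theta> xs us" and ?z' = "rollout P k x' \<theta>' xs' us'"
    let ?u = "feedback P ?z \<theta> xs us" and ?u' = "feedback P ?z' \<theta>' xs' us'"
    have u: "?u \<in> inputs P" "?u' \<in> inputs P" using * by (auto intro!: feedback_in_inputs[OF wp])
    have d: "0 \<le> \<delta>" using * norm_ge_zero order_trans by blast
    have "\<delta> \<le> A ^ k * \<delta>" using mult_right_mono[OF one_le_power[OF A, of k] d] by simp
    then have "norm (?z' - ?z) + norm (?u' - ?u) + norm (\<theta>' - \<theta>) \<le> (2 + 4 * F) * (A ^ k * \<delta>)"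
      using Suc fb[OF Suc one_le_power[OF A] *] * by (simp add: algebra_simps)
    then have "L * (norm (?z' - ?z) + norm (?u' - ?u) + norm (\<theta>' - \<theta>)) \<le> L * ((2 + 4 * F) * (A ^ k * \<delta>))"
      by (intro mult_left_mono L0)
    also have "\<dots> \<le> A ^ Suc k * \<delta>"
      using A d by (simp add: A_def algebra_simps)
    finally show ?case
      using L[OF u *(4,5), of ?z' ?z] by (simp add: Let_def)
  qed
  \<comment> \<open>The summand 1 covers the state error and \<open>4 * F\<close> the input error,
    so one constant serves both claims.\<close>
  define B where "B = (1 + 4 * F) * A ^ n"
  have bound: "norm (rollout P k x' \<theta>' xs' us' - rollout P k x \<theta> xs us) \<le> B * \<delta>"
    "norm (feedback P (rollout P k x' \<theta>' xs' us') \<theta>' xs' us'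
      - feedback P (rollout P k x \<theta> xs us) \<theta> xs us) \<le> B * \<delta>"
    if k: "k \<le> n" and x: "norm (x' - x) \<le> \<delta>" and *: "norm (\<theta>' - \<theta>) \<le> \<delta>" "norm (xs' - xs) \<le> \<delta>" "norm (us' - us) \<le> \<delta>"
      "\<theta> \<in> params P" "\<theta>' \<in> params P" "xs \<in> states P" "xs' \<in> states P" "us \<in> inputs P" "us' \<in> inputs P"
    for x x' \<theta> \<theta>' xs xs' us us' \<delta> k
  proof -
    have d: "0 \<le> \<delta>" using * norm_ge_zero order_trans by blast
    then have "A ^ k * \<delta> \<le> A ^ n * \<delta>" using power_increasing[OF k A] by (intro mult_right_mono)
    with step[OF x *, of k]
    have 1: "norm (rollout P k x' \<theta>' xs' us' - rollout P k x \<theta> xs us) \<le> A ^ n * \<delta>" by linarith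
    have "0 \<le> A ^ n * \<delta>" using A d by simp
    then have "0 \<le> F * (A ^ n * \<delta>)" using F0 by simp
    then have "A ^ n * \<delta> \<le> B * \<delta>" "4 * F * (A ^ n * \<delta>) \<le> B * \<delta>"
      using \<open>0 \<le> A ^ n * \<delta>\<close> unfolding B_def by (simp_all add: algebra_simps)
    with 1 fb[OF 1 one_le_power[OF A] *]
    show "norm (rollout P k x' \<theta>' xs' us' - rollout P k x \<theta> xs us) \<le> B * \<delta>"
      "norm (feedback P (rollout P k x' \<theta>' xs' us') \<theta>' xs' us'
        - feedback P (rollout P k x \<theta> xs us) \<theta> xs us) \<le> B * \<delta>" by linarith+
  qed
  have "1 * 1 \<le> B" unfolding B_def using F0 one_le_power[OF A] by (intro mult_mono) auto
  then have "1 \<le> B" by simp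
  then show thesis by (rule that[of B]) (intro conjI bound)
qed

text \<open>Trajectories over a fixed number of steps differ by a multiple of \<delta>, and each
  stage cost is compared only once with its counterpart. Hence the factor \<open>1 + e\<close> does
  not compound along the horizon.\<close>

lemma tracking_cost_perturb:
  fixes P :: "('nx::finite, 'nu::finite, 'np::finite, 'nw::finite, 'ny::finite) mpc"
  assumes wp: "well_posed P" and reg: "regular P" and les: "locally_exp_stabilizable P"
    and e: "e > 0" and tw: "term_weight P \<ge> 0"
  obtains K where "K \<ge> 0"
    and "\<And>x x' \<delta> \<theta> \<theta>' uu xs xs' us us'. \<lbrakk>\<theta> \<in> params P; \<theta>' \<in> params P;
      uu \<in> {..<horizon P} \<rightarrow>\<^sub>E inputs P;
      xs \<in> states P; xs' \<in> states P; us \<in> inputs P; us' \<in> inputs P; norm (x' - x) \<le> \<delta>;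
      norm (\<theta>' - \<theta>) \<le> \<delta>; norm (xs' - xs) \<le> \<delta>; norm (us' - us) \<le> \<delta>\<rbrakk> \<Longrightarrow>
      tracking_cost P x' \<theta>' uu xs' us' \<le> (1 + e) * tracking_cost P x \<theta> uu xs us + K * \<delta>\<^sup>2"
proof -
  obtain S where S0: "S \<ge> 0" and S: "\<And>x u xs us x' u' xs' us' \<delta>. \<lbrakk>norm (x' - x) \<le> \<delta>; norm (u' - u) \<le> \<delta>;
    norm (xs' - xs) \<le> \<delta>; norm (us' - us) \<le> \<delta>\<rbrakk> \<Longrightarrow>
    stage_cost P x' u' xs' us' \<le> (1 + e) * stage_cost P x u xs us + S * \<delta>\<^sup>2"
    using that by (rule stage_cost_perturb[OF wp e])
  obtain B1 where B1: "B1 \<ge> 1" and pred: "\<And>k x x' \<delta> \<theta> \<theta>' uu. \<lbrakk>k \<le> horizon P; \<theta> \<in> params P; \<theta>' \<in> params P;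
      uu \<in> {..<horizon P} \<rightarrow>\<^sub>E inputs P; norm (x' - x) \<le> \<delta>; norm (\<theta>' - \<theta>) \<le> \<delta>\<rbrakk> \<Longrightarrow>
    norm (predicted_state P uu k x' \<theta>' - predicted_state P uu k x \<theta>) \<le> B1 * \<delta>"
    using that by (rule predicted_state_perturb[OF reg, of "horizon P"])
  obtain B2 where B2: "B2 \<ge> 1" and roll: "\<And>k x x' \<delta> \<theta> \<theta>' xs xs' us us'. \<lbrakk>k \<le> term_steps P; \<theta> \<in> params P; \<theta>' \<in> params P;
    xs \<in> states P; xs' \<in> states P; us \<in> inputs P; us' \<in> inputs P; norm (x' - x) \<le> \<delta>; norm (\<theta>' - \<theta>) \<le> \<delta>;
    norm (xs' - xs) \<le> \<delta>; norm (us' - us) \<le> \<delta>\<rbrakk> \<Longrightarrow>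
    norm (rollout P k x' \<theta>' xs' us' - rollout P k x \<theta> xs us) \<le> B2 * \<delta> \<and>
    norm (feedback P (rollout P k x' \<theta>' xs' us') \<theta>' xs' us'
      - feedback P (rollout P k x \<theta> xs us) \<theta> xs us) \<le> B2 * \<delta>"
    using that by (rule rollout_perturb[OF wp reg les, of "term_steps P"])
  \<comment> \<open>The prediction enlarges the error \<delta> to \<open>B1 * \<delta>\<close>. The
    terminal rollout starts with that error and enlarges it to
    \<open>B2 * B1 * \<delta>\<close>.\<close>
  define K where "K = horizon P * (S * B1\<^sup>2) + term_weight P * (term_steps P * (S * (B2 * B1)\<^sup>2))"
  have K0: "K \<ge> 0" unfolding K_def using S0 tw by simp
  have "tracking_cost P x' \<theta>' uu xs' us' \<le> (1 + e) * tracking_cost P x \<theta> uu xs us + K * \<delta>\<^sup>2"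
    if *: "\<theta> \<in> params P" "\<theta>' \<in> params P" and uu: "uu \<in> {..<horizon P} \<rightarrow>\<^sub>E inputs P"
      and s: "xs \<in> states P" "xs' \<in> states P" "us \<in> inputs P" "us' \<in> inputs P"
      and d: "norm (x' - x) \<le> \<delta>" "norm (\<theta>' - \<theta>) \<le> \<delta>" "norm (xs' - xs) \<le> \<delta>" "norm (us' - us) \<le> \<delta>"
    for x x' \<delta> \<theta> \<theta>' uu xs xs' us us'
  proof -
    have d0: "0 \<le> \<delta>" using d norm_ge_zero order_trans by blast
    have d1: "\<delta> \<le> B1 * \<delta>" using mult_right_mono[OF B1 d0] by simp
    have d2: "B1 * \<delta> \<le> B2 * (B1 * \<delta>)" using mult_right_mono[OF B2, of "B1 * \<delta>"] d0 d1 by simp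
    let ?z = "predicted_state P uu (horizon P) x \<theta>" and ?z' = "predicted_state P uu (horizon P) x' \<theta>'"
    have z: "norm (?z' - ?z) \<le> B1 * \<delta>" using pred * uu d by blast
    have "(\<Sum>k<horizon P. stage_cost P (predicted_state P uu k x' \<theta>') (uu k) xs' us')
      \<le> (\<Sum>k<horizon P. (1 + e) * stage_cost P (predicted_state P uu k x \<theta>) (uu k) xs us + S * (B1 * \<delta>)\<^sup>2)"
      using d d1 d0 by (intro sum_mono S pred * uu) auto
    also have "\<dots> = (1 + e) * (\<Sum>k<horizon P. stage_cost P (predicted_state P uu k x \<theta>) (uu k) xs us)
        + horizon P * (S * B1\<^sup>2) * \<delta>\<^sup>2"
      by (simp add: sum.distrib sum_distrib_left power_mult_distrib)
    finally have 1: "(\<Sum>k<horizon P. stage_cost P (predicted_state P uu k x' \<theta>') (uu k) xs' us') \<le> \<dots>" .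
    have "terminal_cost P ?z' xs' us' \<theta>' \<le> (\<Sum>k<term_steps P. (1 + e) * rollout_cost P k ?z \<theta> xs us + S * (B2 * (B1 * \<delta>))\<^sup>2)"
      unfolding terminal_cost_def
    proof (rule sum_mono)
      fix k assume "k \<in> {..<term_steps P}"
      then have "k \<le> term_steps P" by simp
      from roll[OF this * s z] d d1 d2
      show "rollout_cost P k ?z' \<theta>' xs' us' \<le> (1 + e) * rollout_cost P k ?z \<theta> xs us + S * (B2 * (B1 * \<delta>))\<^sup>2"
        unfolding rollout_cost_def Let_def by (intro S) auto
    qed
    also have "\<dots> = (1 + e) * terminal_cost P ?z xs us \<theta> + (term_steps P * (S * (B2 * B1)\<^sup>2)) * \<delta>\<^sup>2"
      by (simp add: terminal_cost_def sum.distrib sum_distrib_left power_mult_distrib)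
    finally have 2: "term_weight P * terminal_cost P ?z' xs' us' \<theta>' \<le> term_weight P * \<dots>"
      using tw by (rule mult_left_mono)
    show ?thesis using 1 2 unfolding tracking_cost_def K_def by (simp add: algebra_simps)
  qed
  with K0 show thesis by (rule that)
qed

section \<open>Setpoints of neighbouring parameters\<close>

lemma setpoint_mapE:
  fixes P :: "('nx::finite, 'nu::finite, 'np::finite, 'nw::finite, 'ny::finite) mpc"
  assumes "setpoint_conditions P rd"
  obtains gx gu Lg where "\<And>\<theta> x u y. \<theta> \<in> params P \<Longrightarrow> (x, u, y) \<in> setpoints P \<theta> \<Longrightarrow> x = gx y \<theta> \<and> u = gu y \<theta>"
    and "Lg \<ge> 0" and "\<And>y y' \<theta> \<theta>'. \<theta> \<in> params P \<Longrightarrow> \<theta>' \<in> params P \<Longrightarrow>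
      (wnorm (wQ P) (gx y \<theta> - gx y' \<theta>'))\<^sup>2 + (wnorm (wR P) (gu y \<theta> - gu y' \<theta>'))\<^sup>2
             \<le> Lg * ((wnorm (wT P) (y - y'))\<^sup>2 + (norm (\<theta> - \<theta>'))\<^sup>2)"
    and "\<And>\<theta> x1 u1 y1 x2 u2 y2 \<beta>. \<theta> \<in> params P \<Longrightarrow> (x1, u1, y1) \<in> setpoints P \<theta> \<Longrightarrow>
      (x2, u2, y2) \<in> setpoints P \<theta> \<Longrightarrow> \<beta> \<in> {0..1} \<Longrightarrow>
      (gx (\<beta> *\<^sub>R y1 + (1 - \<beta>) *\<^sub>R y2) \<theta>, gu (\<beta> *\<^sub>R y1 + (1 - \<beta>) *\<^sub>R y2) \<theta>, \<beta> *\<^sub>R y1 + (1 - \<beta>) *\<^sub>R y2) \<in> setpoints P \<theta>"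
proof -
  from assms obtain gx gu where
    g: "\<forall>\<theta>\<in>params P. \<forall>(x, u, y)\<in>setpoints P \<theta>. x = gx y \<theta> \<and> u = gu y \<theta>"
    and L: "\<exists>Lg\<ge>0. \<forall>y y'. \<forall>\<theta>\<in>params P. \<forall>\<theta>'\<in>params P.
           (wnorm (wQ P) (gx y \<theta> - gx y' \<theta>'))\<^sup>2 + (wnorm (wR P) (gu y \<theta> - gu y' \<theta>'))\<^sup>2
             \<le> Lg * ((wnorm (wT P) (y - y'))\<^sup>2 + (norm (\<theta> - \<theta>'))\<^sup>2)"
    and c: "\<forall>\<theta>\<in>params P. \<forall>(x1, u1, y1)\<in>setpoints P \<theta>. \<forall>(x2, u2, y2)\<in>setpoints P \<theta>. \<forall>\<beta>\<in>{0..1}.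
           (let y = \<beta> *\<^sub>R y1 + (1 - \<beta>) *\<^sub>R y2 in (gx y \<theta>, gu y \<theta>, y) \<in> setpoints P \<theta>)"
    unfolding setpoint_conditions_def by blast
  from L obtain Lg where Lg: "Lg \<ge> 0" "\<And>y y' \<theta> \<theta>'. \<theta> \<in> params P \<Longrightarrow> \<theta>' \<in> params P \<Longrightarrow>
      (wnorm (wQ P) (gx y \<theta> - gx y' \<theta>'))\<^sup>2 + (wnorm (wR P) (gu y \<theta> - gu y' \<theta>'))\<^sup>2
             \<le> Lg * ((wnorm (wT P) (y - y'))\<^sup>2 + (norm (\<theta> - \<theta>'))\<^sup>2)" by blast
  have conv: "(gx (\<beta> *\<^sub>R y1 + (1 - \<beta>) *\<^sub>R y2) \<theta>, gu (\<beta> *\<^sub>R y1 + (1 - \<beta>) *\<^sub>R y2) \<theta>, \<beta> *\<^sub>R y1 + (1 - \<beta>) *\<^sub>R y2) \<in> setpoints P \<theta>"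
    if "\<theta> \<in> params P" "(x1, u1, y1) \<in> setpoints P \<theta>" "(x2, u2, y2) \<in> setpoints P \<theta>" "\<beta> \<in> {0..1}"
    for \<theta> x1 u1 y1 x2 u2 y2 \<beta>
    using bspec[OF bspec[OF bspec[OF bspec[OF c that(1)] that(2), simplified] that(3), simplified] that(4)]
    by (simp add: Let_def)
  show thesis
  proof (rule that[OF _ Lg conv])
    show "x = gx y \<theta> \<and> u = gu y \<theta>" if "\<theta> \<in> params P" "(x, u, y) \<in> setpoints P \<theta>" for \<theta> x u y
      using bspec[OF bspec[OF g that(1)] that(2)] by simp
  qed
qed

text \<open>The last setpoint condition supplies a setpoint for the new parameter whose output is
  close. The Lipschitz map from output and parameter to the setpoint then makes its state and input
  close as well.\<close>

lemma setpoint_transfer: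
  fixes P :: "('nx::finite, 'nu::finite, 'np::finite, 'nw::finite, 'ny::finite) mpc"
  assumes wp: "well_posed P" and reg: "regular P" and sc: "setpoint_conditions P rd"
  obtains K where "K \<ge> 0"
    and "\<And>\<theta> \<theta>' xs us ys. \<lbrakk>\<theta> \<in> params P; \<theta>' \<in> params P; (xs, us, ys) \<in> setpoints P \<theta>\<rbrakk> \<Longrightarrow>
      \<exists>xs' us' ys'. (xs', us', ys') \<in> setpoints P \<theta>' \<and>
        norm (xs' - xs) \<le> K * norm (\<theta>' - \<theta>) \<and> norm (us' - us) \<le> K * norm (\<theta>' - \<theta>) \<and>
        (wnorm (wT P) (ys' - ys))\<^sup>2 \<le> (K * norm (\<theta>' - \<theta>))\<^sup>2"
proof -
  have Q: "pos_def (wQ P)" and R: "pos_def (wR P)" and T: "pos_def (wT P)"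
    using wp unfolding well_posed_def by auto
  obtain gx gu Lg where g: "\<And>\<theta> x u y. \<theta> \<in> params P \<Longrightarrow> (x, u, y) \<in> setpoints P \<theta> \<Longrightarrow> x = gx y \<theta> \<and> u = gu y \<theta>"
    and Lg0: "Lg \<ge> 0" and Lg: "\<And>y y' \<theta> \<theta>'. \<theta> \<in> params P \<Longrightarrow> \<theta>' \<in> params P \<Longrightarrow>
      (wnorm (wQ P) (gx y \<theta> - gx y' \<theta>'))\<^sup>2 + (wnorm (wR P) (gu y \<theta> - gu y' \<theta>'))\<^sup>2
             \<le> Lg * ((wnorm (wT P) (y - y'))\<^sup>2 + (norm (\<theta> - \<theta>'))\<^sup>2)"
    using that by (rule setpoint_mapE[OF sc])
  obtain Ls where Ls0: "Ls \<ge> 0" and Ls': "\<forall>\<theta>\<in>params P. \<forall>\<theta>'\<in>params P. \<forall>(xs, us, ys)\<in>setpoints P \<theta>.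
      (INF (xs', us', ys')\<in>setpoints P \<theta>'. (wnorm (wT P) (ys - ys'))\<^sup>2) \<le> Ls * (norm (\<theta> - \<theta>'))\<^sup>2"
    using sc unfolding setpoint_conditions_def by blast
  have Ls: "(INF (xs', us', ys')\<in>setpoints P \<theta>'. (wnorm (wT P) (ys - ys'))\<^sup>2) \<le> Ls * (norm (\<theta> - \<theta>'))\<^sup>2"
    if "\<theta> \<in> params P" "\<theta>' \<in> params P" "(xs, us, ys) \<in> setpoints P \<theta>" for \<theta> \<theta>' xs us ys
    using bspec[OF bspec[OF bspec[OF Ls' that(1)] that(2)] that(3)] by simp
  obtain KQ where KQ: "KQ \<ge> 0" "\<And>z. (norm z)\<^sup>2 \<le> KQ * (wnorm (wQ P) z)\<^sup>2"
    using norm_power2_le_wnorm[OF Q] by blast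
  obtain KR where KR: "KR \<ge> 0" "\<And>z. (norm z)\<^sup>2 \<le> KR * (wnorm (wR P) z)\<^sup>2"
    using norm_power2_le_wnorm[OF R] by blast
  \<comment> \<open>Here \<open>Ls + 2\<close> adds the output bound \<open>Ls + 1\<close> and the
    parameter distance in the Lipschitz estimate of the setpoint map. \<open>K\<close> majorizes all
    constants that occur and is at least 1, so each of them is also at most its square.\<close>
  define c where "c = Lg * (Ls + 2)"
  define K where "K = 1 + KQ * c + KR * c + (Ls + 1)"
  have c0: "c \<ge> 0" using Lg0 Ls0 unfolding c_def by simp
  have nn: "KQ * c \<ge> 0" "KR * c \<ge> 0" using c0 KQ KR by simp_all
  then have K: "K \<ge> 1" "KQ * c \<le> K" "KR * c \<le> K" "Ls + 1 \<le> K" using Ls0 unfolding K_def by simp_all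
  have sq: "a * t\<^sup>2 \<le> (K * t)\<^sup>2" if "a \<le> K" for a t :: real
  proof -
    have "K * 1 \<le> K * K" using K(1) by (intro mult_left_mono) auto
    with that have "a \<le> K * K" by linarith
    then have "a * t\<^sup>2 \<le> K * K * t\<^sup>2" by (rule mult_right_mono) simp
    then show ?thesis by (simp add: power2_eq_square mult_ac)
  qed
  have "\<exists>xs' us' ys'. (xs', us', ys') \<in> setpoints P \<theta>' \<and>
      norm (xs' - xs) \<le> K * norm (\<theta>' - \<theta>) \<and> norm (us' - us) \<le> K * norm (\<theta>' - \<theta>) \<and>
      (wnorm (wT P) (ys' - ys))\<^sup>2 \<le> (K * norm (\<theta>' - \<theta>))\<^sup>2"
    if th: "\<theta> \<in> params P" "\<theta>' \<in> params P" and s: "(xs, us, ys) \<in> setpoints P \<theta>" for \<theta> \<theta>' xs us ys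
  \<comment> \<open>A concrete setpoint is drawn from the infimum by relaxing \<open>Ls\<close> to
    \<open>Ls + 1\<close>. This slack is strict only for distinct parameters; for equal ones the old
    setpoint is kept.\<close>
  proof (cases "\<theta>' = \<theta>")
    case True
    with s show ?thesis
      by (intro exI[of _ xs] exI[of _ us] exI[of _ ys]) (simp add: wnorm_def)
  next
    case False
    define \<Delta> where "\<Delta> = norm (\<theta>' - \<theta>)"
    have \<Delta>: "\<Delta> > 0" "norm (\<theta> - \<theta>') = \<Delta>" using False by (simp_all add: \<Delta>_def norm_minus_commute)
    have "(INF (xs', us', ys')\<in>setpoints P \<theta>'. (wnorm (wT P) (ys - ys'))\<^sup>2) \<le> Ls * \<Delta>\<^sup>2"
      using Ls[OF th s] by (simp add: \<Delta>(2))
    also have "\<dots> < (Ls + 1) * \<Delta>\<^sup>2" using \<Delta>(1) by (simp add: algebra_simps)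
    finally have "\<exists>s'\<in>setpoints P \<theta>'. (\<lambda>(xs', us', ys'). (wnorm (wT P) (ys - ys'))\<^sup>2) s' < (Ls + 1) * \<Delta>\<^sup>2"
      using reg th by (subst (asm) cInf_less_iff) (auto simp: regular_def intro!: bdd_belowI[of _ 0])
    then obtain xs' us' ys' where s': "(xs', us', ys') \<in> setpoints P \<theta>'"
      and "(wnorm (wT P) (ys - ys'))\<^sup>2 < (Ls + 1) * \<Delta>\<^sup>2" by auto
    then have y: "(wnorm (wT P) (ys' - ys))\<^sup>2 \<le> (Ls + 1) * \<Delta>\<^sup>2"
      by (subst wnorm_power2_minus[OF T]) simp
    have "(wnorm (wQ P) (xs' - xs))\<^sup>2 + (wnorm (wR P) (us' - us))\<^sup>2
        \<le> Lg * ((wnorm (wT P) (ys' - ys))\<^sup>2 + \<Delta>\<^sup>2)"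
      using Lg[OF th(2,1), of ys' ys] g[OF th(1) s] g[OF th(2) s'] by (simp add: \<Delta>_def)
    also have "\<dots> \<le> Lg * ((Ls + 1) * \<Delta>\<^sup>2 + \<Delta>\<^sup>2)"
      using y by (intro mult_left_mono Lg0) simp
    finally have "(wnorm (wQ P) (xs' - xs))\<^sup>2 + (wnorm (wR P) (us' - us))\<^sup>2 \<le> c * \<Delta>\<^sup>2"
      by (simp add: c_def algebra_simps)
    then have x: "(wnorm (wQ P) (xs' - xs))\<^sup>2 \<le> c * \<Delta>\<^sup>2" and u: "(wnorm (wR P) (us' - us))\<^sup>2 \<le> c * \<Delta>\<^sup>2"
      using zero_le_power2[of "wnorm (wQ P) (xs' - xs)"] zero_le_power2[of "wnorm (wR P) (us' - us)"]
      by linarith+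
    have "0 \<le> K * \<Delta>" using K \<Delta> by simp
    have "(norm (xs' - xs))\<^sup>2 \<le> (KQ * c) * \<Delta>\<^sup>2"
      using KQ(2)[of "xs' - xs"] mult_left_mono[OF x KQ(1)] by simp
    also have "\<dots> \<le> (K * \<Delta>)\<^sup>2" by (rule sq[OF K(2)])
    finally have "norm (xs' - xs) \<le> K * \<Delta>" using \<open>0 \<le> K * \<Delta>\<close> by (rule power2_le_imp_le)
    have "(norm (us' - us))\<^sup>2 \<le> (KR * c) * \<Delta>\<^sup>2"
      using KR(2)[of "us' - us"] mult_left_mono[OF u KR(1)] by simp
    also have "\<dots> \<le> (K * \<Delta>)\<^sup>2" by (rule sq[OF K(3)])
    finally have "norm (us' - us) \<le> K * \<Delta>" using \<open>0 \<le> K * \<Delta>\<close> by (rule power2_le_imp_le)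
    moreover have "(wnorm (wT P) (ys' - ys))\<^sup>2 \<le> (K * \<Delta>)\<^sup>2" using y sq[OF K(4)] order_trans by blast
    ultimately show ?thesis using s' \<open>norm (xs' - xs) \<le> K * \<Delta>\<close> unfolding \<Delta>_def by blast
  qed
  moreover have "K \<ge> 0" using K by simp
  ultimately show thesis using that by blast
qed

section \<open>The optimal value: attainment and perturbation\<close>

lemma tracking_cost_nonneg:
  assumes "well_posed P" "term_weight P \<ge> 0"
  shows "0 \<le> tracking_cost P x \<theta> uu xs us"
  unfolding tracking_cost_def terminal_cost_def rollout_cost_def Let_def
  by (intro add_nonneg_nonneg mult_nonneg_nonneg sum_nonneg stage_cost_nonneg assms)

lemma mpc_value_le:
  assumes "well_posed P" "term_weight P \<ge> 0" "s \<in> mpc_feasible P \<theta>"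
  shows "mpc_value P x \<theta> \<le> mpc_objective P x \<theta> s"
  unfolding mpc_value_def
proof (rule cINF_lower)
  show "bdd_below (mpc_objective P x \<theta> ` mpc_feasible P \<theta>)"
    using tracking_cost_nonneg[OF assms(1,2)] by (intro bdd_belowI[of _ 0]) auto
qed (rule assms)

lemma mpc_value_minimizer:
  assumes "mpc_minimizer P opt" "\<theta> \<in> params P" "opt x \<theta> = (uu, xs, us, ys)"
  shows "mpc_value P x \<theta> = tracking_cost P x \<theta> uu xs us + (wnorm (wT P) (ys - target P))\<^sup>2"
    and "uu \<in> {..<horizon P} \<rightarrow>\<^sub>E inputs P" and "(xs, us, ys) \<in> setpoints P \<theta>"
proof -
  have *: "(uu, xs, us, ys) \<in> mpc_feasible P \<theta>"
    "\<And>s. s \<in> mpc_feasible P \<theta> \<Longrightarrow> mpc_objective P x \<theta> (uu, xs, us, ys) \<le> mpc_objective P x \<theta> s"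
    using assms unfolding mpc_minimizer_def is_arg_min_linorder by metis+
  have "mpc_value P x \<theta> = mpc_objective P x \<theta> (uu, xs, us, ys)"
    unfolding mpc_value_def by (rule cInf_eq_minimum) (use * in blast)+
  then show "mpc_value P x \<theta> = tracking_cost P x \<theta> uu xs us + (wnorm (wT P) (ys - target P))\<^sup>2"
    by simp
  show "uu \<in> {..<horizon P} \<rightarrow>\<^sub>E inputs P" "(xs, us, ys) \<in> setpoints P \<theta>"
    using *(1) unfolding mpc_feasible_def by auto
qed

text \<open>Candidate at the perturbed point: the old input sequence with a nearby setpoint for the new parameter.\<close>

lemma mpc_value_perturb:
  fixes P :: "('nx::finite, 'nu::finite, 'np::finite, 'nw::finite, 'ny::finite) mpc"
  assumes wp: "well_posed P" and reg: "regular P" and les: "locally_exp_stabilizable P"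
    and sc: "setpoint_conditions P rd" and opt: "mpc_minimizer P opt"
    and e: "e > 0" and tw: "term_weight P \<ge> 0"
  obtains K where "K \<ge> 0"
    and "\<And>z d \<theta> \<theta>'. \<lbrakk>\<theta> \<in> params P; \<theta>' \<in> params P\<rbrakk> \<Longrightarrow> mpc_value P (z + d) \<theta>'
      \<le> (1 + e) * mpc_value P z \<theta> + K * ((norm d)\<^sup>2 + (norm (\<theta>' - \<theta>))\<^sup>2)"
proof -
  have T: "pos_def (wT P)" using wp unfolding well_posed_def by auto
  obtain S where S0: "S \<ge> 0" and S: "\<And>\<theta> \<theta>' xs us ys. \<lbrakk>\<theta> \<in> params P; \<theta>' \<in> params P; (xs, us, ys) \<in> setpoints P \<theta>\<rbrakk> \<Longrightarrow>
      \<exists>xs' us' ys'. (xs', us', ys') \<in> setpoints P \<theta>' \<and>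
        norm (xs' - xs) \<le> S * norm (\<theta>' - \<theta>) \<and> norm (us' - us) \<le> S * norm (\<theta>' - \<theta>) \<and>
        (wnorm (wT P) (ys' - ys))\<^sup>2 \<le> (S * norm (\<theta>' - \<theta>))\<^sup>2"
    using that by (rule setpoint_transfer[OF wp reg sc])
  obtain J where J0: "J \<ge> 0"
    and J: "\<And>x x' \<delta> \<theta> \<theta>' uu xs xs' us us'. \<lbrakk>\<theta> \<in> params P; \<theta>' \<in> params P;
      uu \<in> {..<horizon P} \<rightarrow>\<^sub>E inputs P;
      xs \<in> states P; xs' \<in> states P; us \<in> inputs P; us' \<in> inputs P; norm (x' - x) \<le> \<delta>;
      norm (\<theta>' - \<theta>) \<le> \<delta>; norm (xs' - xs) \<le> \<delta>; norm (us' - us) \<le> \<delta>\<rbrakk> \<Longrightarrow>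
      tracking_cost P x' \<theta>' uu xs' us' \<le> (1 + e) * tracking_cost P x \<theta> uu xs us + J * \<delta>\<^sup>2"
    using that by (rule tracking_cost_perturb[OF wp reg les e tw])
  define K1 where "K1 = J + (1 + 1 / e)"
  define K where "K = K1 * (1 + S)\<^sup>2 * 2"
  have K1: "K1 \<ge> 0" using J0 e unfolding K1_def by simp
  have "mpc_value P (z + d) \<theta>' \<le> (1 + e) * mpc_value P z \<theta> + K * ((norm d)\<^sup>2 + (norm (\<theta>' - \<theta>))\<^sup>2)"
    if th: "\<theta> \<in> params P" "\<theta>' \<in> params P" for z d \<theta> \<theta>'
  proof -
    obtain uu xs us ys where "opt z \<theta> = (uu, xs, us, ys)" by (metis prod.collapse)
    note o = mpc_value_minimizer[OF opt th(1) this]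
    from S[OF th o(3)] obtain xs' us' ys' where s': "(xs', us', ys') \<in> setpoints P \<theta>'"
      "norm (xs' - xs) \<le> S * norm (\<theta>' - \<theta>)" "norm (us' - us) \<le> S * norm (\<theta>' - \<theta>)"
      "(wnorm (wT P) (ys' - ys))\<^sup>2 \<le> (S * norm (\<theta>' - \<theta>))\<^sup>2" by blast
    \<comment> \<open>A single radius that dominates the state error, the parameter change and the
      induced shift of the setpoint.\<close>
    define \<delta> where "\<delta> = (1 + S) * (norm d + norm (\<theta>' - \<theta>))"
    have "S * norm (\<theta>' - \<theta>) \<ge> 0" "S * norm d \<ge> 0" using S0 by simp_all
    then have \<delta>: "norm d \<le> \<delta>" "norm (\<theta>' - \<theta>) \<le> \<delta>" "S * norm (\<theta>' - \<theta>) \<le> \<delta>"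
      unfolding \<delta>_def by (simp_all add: algebra_simps)
    have "mpc_value P (z + d) \<theta>' \<le> mpc_objective P (z + d) \<theta>' (uu, xs', us', ys')"
      using o(2) s'(1) by (intro mpc_value_le[OF wp tw]) (simp add: mpc_feasible_def)
    also have "\<dots> = tracking_cost P (z + d) \<theta>' uu xs' us' + (wnorm (wT P) (ys' - target P))\<^sup>2" by simp
    also have "tracking_cost P (z + d) \<theta>' uu xs' us' \<le> (1 + e) * tracking_cost P z \<theta> uu xs us + J * \<delta>\<^sup>2"
      using \<delta> s' setpointsD[OF wp o(3)] setpointsD[OF wp s'(1)] by (intro J th o(2)) auto
    also have "(wnorm (wT P) (ys' - target P))\<^sup>2
        \<le> (1 + e) * (wnorm (wT P) (ys - target P))\<^sup>2 + (1 + 1 / e) * \<delta>\<^sup>2"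
    proof -
      have "(wnorm (wT P) (ys' - target P))\<^sup>2
        \<le> (1 + e) * (wnorm (wT P) (ys - target P))\<^sup>2 + (1 + 1 / e) * (wnorm (wT P) (ys' - ys))\<^sup>2"
        using wnorm_power2_add_le[OF T e, of "ys - target P" "ys' - ys"] by simp
      moreover have "(wnorm (wT P) (ys' - ys))\<^sup>2 \<le> \<delta>\<^sup>2"
        using s'(4) power_mono[OF \<delta>(3), of 2] S0 by simp
      then have "(1 + 1 / e) * (wnorm (wT P) (ys' - ys))\<^sup>2 \<le> (1 + 1 / e) * \<delta>\<^sup>2"
        using e by (intro mult_left_mono) auto
      ultimately show ?thesis by linarith
    qed
    finally have 1: "mpc_value P (z + d) \<theta>' \<le> (1 + e) * mpc_value P z \<theta> + K1 * \<delta>\<^sup>2"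
      unfolding o(1) K1_def by (simp add: algebra_simps)
    \<comment> \<open>This turns the squared sum in \<delta> into the sum of squares of the claim
      and produces the factor 2 in \<open>K\<close>.\<close>
    have "(norm d + norm (\<theta>' - \<theta>))\<^sup>2 \<le> 2 * ((norm d)\<^sup>2 + (norm (\<theta>' - \<theta>))\<^sup>2)"
      using power2_add_le_Young[of 1 "norm d" "norm (\<theta>' - \<theta>)"] by simp
    then have "\<delta>\<^sup>2 \<le> (1 + S)\<^sup>2 * (2 * ((norm d)\<^sup>2 + (norm (\<theta>' - \<theta>))\<^sup>2))"
      unfolding \<delta>_def power_mult_distrib by (rule mult_left_mono) simp
    from mult_left_mono[OF this K1] 1 show ?thesis unfolding K_def mult.assoc by linarith
  qed
  moreover have "K \<ge> 0" using K1 unfolding K_def by simp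
  ultimately show thesis using that by blast
qed

section \<open>Bounding the optimal value by the distance to the artificial setpoint\<close>

lemma rollout_rollout:
  "rollout P k (rollout P n x \<theta> xs us) \<theta> xs us = rollout P (n + k) x \<theta> xs us"
  by (induction k) (simp_all add: Let_def)

text \<open>Applied in open loop, the inputs generated by the feedback reproduce its rollout, and
  the terminal cost continues this rollout from the end of the horizon. The tracking cost is
  therefore a weighted sum of rollout costs of a single trajectory.\<close>

lemma tracking_cost_feedback_le:
  fixes P :: "('nx::finite, 'nu::finite, 'np::finite, 'nw::finite, 'ny::finite) mpc"
  assumes "term_weight P \<ge> 0" and c: "\<And>k. rollout_cost P k x \<theta> xs us \<le> c"
  shows "tracking_cost P x \<theta> (restrict (\<lambda>k. feedback P (rollout P k x \<theta> xs us) \<theta> xs us) {..<horizon P}) xs us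
    \<le> (horizon P + term_weight P * term_steps P) * c"
proof -
  let ?uu = "restrict (\<lambda>k. feedback P (rollout P k x \<theta> xs us) \<theta> xs us) {..<horizon P}"
  \<comment> \<open>The state after \<open>k\<close> steps depends only on inputs with index below
    \<open>k\<close>, which \<open>restrict\<close> leaves unchanged as long as \<open>k\<close>
    does not exceed the horizon.\<close>
  have pred: "predicted_state P ?uu k x \<theta> = rollout P k x \<theta> xs us" if "k \<le> horizon P" for k
    using that by (induction k) (simp_all add: Let_def)
  have "(\<Sum>k<horizon P. stage_cost P (predicted_state P ?uu k x \<theta>) (?uu k) xs us)
      = (\<Sum>k<horizon P. rollout_cost P k x \<theta> xs us)"
    by (rule sum.cong) (simp_all add: pred rollout_cost_def Let_def)
  also have "\<dots> \<le> horizon P * c" 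
    using sum_bounded_above[of "{..<horizon P}" "\<lambda>k. rollout_cost P k x \<theta> xs us" c] c by simp
  finally have 1: "(\<Sum>k<horizon P. stage_cost P (predicted_state P ?uu k x \<theta>) (?uu k) xs us) \<le> horizon P * c" .
  have "terminal_cost P (predicted_state P ?uu (horizon P) x \<theta>) xs us \<theta>
      = (\<Sum>k<term_steps P. rollout_cost P (horizon P + k) x \<theta> xs us)"
    unfolding terminal_cost_def pred[OF order_refl] rollout_cost_def rollout_rollout ..
  also have "\<dots> \<le> term_steps P * c" 
    using sum_bounded_above[of "{..<term_steps P}" "\<lambda>k. rollout_cost P (horizon P + k) x \<theta> xs us" c] c by simp
  finally have "term_weight P * terminal_cost P (predicted_state P ?uu (horizon P) x \<theta>) xs us \<theta>
      \<le> term_weight P * (term_steps P * c)"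
    using assms(1) by (rule mult_left_mono)
  with 1 show ?thesis unfolding tracking_cost_def by (simp add: algebra_simps)
qed

text \<open>
  Let \<open>a\<close> be the squared distance of the state to the optimal artificial setpoint and \<open>b\<close> that
  setpoint's offset cost. Moving the setpoint's output by a fraction \<open>\<eta>\<close> towards the target shrinks
  \<open>b\<close> by a factor \<open>(1 - \<eta>)\<^sup>2\<close> but adds only \<open>O(\<eta>\<^sup>2 b)\<close> to the tracking cost. Comparing with the optimum
  bounds \<open>\<eta> b\<close> by a multiple of \<open>a\<close>.
\<close>

lemma mpc_value_le_state_error:
  fixes P :: "('nx::finite, 'nu::finite, 'np::finite, 'nw::finite, 'ny::finite) mpc"
  assumes wp: "well_posed P" and osp: "optimal_setpoint P rd" and les: "locally_exp_stabilizable P"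
    and sc: "setpoint_conditions P rd" and opt: "mpc_minimizer P opt"
    and tw: "term_weight P \<ge> 0" and hor: "horizon P \<ge> 1" and Jbar: "Jbar > 0"
  obtains C where "C > 0"
    and "\<And>x \<theta> uu xs us ys. \<lbrakk>(x, \<theta>) \<in> sublevel P Jbar; opt x \<theta> = (uu, xs, us, ys)\<rbrakk> \<Longrightarrow>
      mpc_value P x \<theta> \<le> C * (wnorm (wQ P) (x - xs))\<^sup>2"
proof -
  have Q: "pos_def (wQ P)" and T: "pos_def (wT P)" using wp unfolding well_posed_def by auto
  obtain gx gu Lg where g: "\<And>\<theta> x u y. \<theta> \<in> params P \<Longrightarrow> (x, u, y) \<in> setpoints P \<theta> \<Longrightarrow> x = gx y \<theta> \<and> u = gu y \<theta>"
    and Lg0: "Lg \<ge> 0" and Lg: "\<And>y y' \<theta> \<theta>'. \<theta> \<in> params P \<Longrightarrow> \<theta>' \<in> params P \<Longrightarrow>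
      (wnorm (wQ P) (gx y \<theta> - gx y' \<theta>'))\<^sup>2 + (wnorm (wR P) (gu y \<theta> - gu y' \<theta>'))\<^sup>2
             \<le> Lg * ((wnorm (wT P) (y - y'))\<^sup>2 + (norm (\<theta> - \<theta>'))\<^sup>2)"
    and conv: "\<And>\<theta> x1 u1 y1 x2 u2 y2 \<beta>. \<theta> \<in> params P \<Longrightarrow> (x1, u1, y1) \<in> setpoints P \<theta> \<Longrightarrow>
      (x2, u2, y2) \<in> setpoints P \<theta> \<Longrightarrow> \<beta> \<in> {0..1} \<Longrightarrow>
      (gx (\<beta> *\<^sub>R y1 + (1 - \<beta>) *\<^sub>R y2) \<theta>, gu (\<beta> *\<^sub>R y1 + (1 - \<beta>) *\<^sub>R y2) \<theta>, \<beta> *\<^sub>R y1 + (1 - \<beta>) *\<^sub>R y2) \<in> setpoints P \<theta>"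
    using that by (rule setpoint_mapE[OF sc])
  obtain c C \<rho> where c: "c > 0" and C: "C \<ge> 1" and \<rho>': "\<rho> \<in> {0<..<1}"
    and roll': "\<forall>k. \<forall>\<theta>\<in>params P. \<forall>(xs, us, ys)\<in>setpoints P \<theta>. \<forall>x. (wnorm (wQ P) (x - xs))\<^sup>2 \<le> c \<longrightarrow>
      rollout_cost P k x \<theta> xs us \<le> C * \<rho> ^ k * (wnorm (wQ P) (x - xs))\<^sup>2"
    using les unfolding locally_exp_stabilizable_def by blast
  have \<rho>: "0 < \<rho>" "\<rho> < 1" using \<rho>' by auto
  have roll: "rollout_cost P k x \<theta> xs us \<le> C * \<rho> ^ k * (wnorm (wQ P) (x - xs))\<^sup>2"
    if "\<theta> \<in> params P" "(xs, us, ys) \<in> setpoints P \<theta>" "(wnorm (wQ P) (x - xs))\<^sup>2 \<le> c" for k \<theta> xs us ys x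
    using bspec[OF bspec[OF spec[OF roll', of k] that(1)] that(2)] that(3) by simp
  define C1 where "C1 = (horizon P + term_weight P * term_steps P) * C"
  have C1: "C1 \<ge> 0" using C tw unfolding C1_def by simp
  \<comment> \<open>The first bound makes the linear gain in the offset cost outweigh the quadratic
    tracking loss. The second permits a convex combination. The third keeps the state within the
    region of local stabilizability of the shifted setpoint; \<open>Lg + 1\<close> avoids a zero
    denominator.\<close>
  define \<eta> where "\<eta> = min (1 / (2 * C1 * Lg + 1)) (min 1 (c / (4 * (Lg + 1) * Jbar)))"
  have p: "2 * C1 * Lg \<ge> 0" using C1 Lg0 by simp
  have \<eta>: "0 < \<eta>" "\<eta> \<le> 1" using p c Lg0 Jbar unfolding \<eta>_def by auto
  have \<eta>1: "\<eta> * (2 * C1 * Lg + 1) \<le> 1"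
  proof -
    have "\<eta> \<le> 1 / (2 * C1 * Lg + 1)" unfolding \<eta>_def by simp
    then show ?thesis using p by (simp add: pos_le_divide_eq)
  qed
  have \<eta>2: "2 * Lg * \<eta>\<^sup>2 * Jbar \<le> c / 2"
  proof -
    have "\<eta> \<le> c / (4 * (Lg + 1) * Jbar)" unfolding \<eta>_def by simp
    then have "\<eta> * (4 * (Lg + 1) * Jbar) \<le> c" using Lg0 Jbar by (simp add: pos_le_divide_eq)
    moreover have "\<eta>\<^sup>2 * (4 * Lg * Jbar) \<le> \<eta> * (4 * (Lg + 1) * Jbar)"
      using \<eta> Lg0 Jbar by (intro mult_mono) (auto simp: power2_eq_square mult_left_le)
    moreover have "\<eta>\<^sup>2 * (4 * Lg * Jbar) = 2 * (2 * Lg * \<eta>\<^sup>2 * Jbar)" by simp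
    ultimately show ?thesis by linarith
  qed
  \<comment> \<open>The first two summands come from the case of a state near its artificial
    setpoint, the third from the case of a distant one.\<close>
  define K where "K = 2 * C1 + 2 * C1 / \<eta> + 4 * Jbar / c"
  have K: "K > 0" unfolding K_def using C1 \<eta> c Jbar by (intro add_nonneg_pos) auto
  have "mpc_value P x \<theta> \<le> K * (wnorm (wQ P) (x - xs))\<^sup>2"
    if sub: "(x, \<theta>) \<in> sublevel P Jbar" and op: "opt x \<theta> = (uu, xs, us, ys)" for x \<theta> uu xs us ys
  proof -
    define a where "a = (wnorm (wQ P) (x - xs))\<^sup>2"
    define b where "b = (wnorm (wT P) (ys - target P))\<^sup>2"
    have ab: "a \<ge> 0" "b \<ge> 0" unfolding a_def b_def by simp_all
    have th: "\<theta> \<in> params P" and V: "mpc_value P x \<theta> \<le> Jbar" using sub unfolding sublevel_def by auto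
    note o = mpc_value_minimizer[OF opt th op]
    have "a \<le> tracking_cost P x \<theta> uu xs us"
    proof -
      have "a \<le> stage_cost P (predicted_state P uu 0 x \<theta>) (uu 0) xs us"
        unfolding a_def using stage_cost_ge[OF wp] by simp
      also have "\<dots> \<le> (\<Sum>k<horizon P. stage_cost P (predicted_state P uu k x \<theta>) (uu k) xs us)"
        using hor by (intro member_le_sum stage_cost_nonneg[OF wp]) auto
      also have "\<dots> \<le> tracking_cost P x \<theta> uu xs us"
        unfolding tracking_cost_def terminal_cost_def rollout_cost_def Let_def using tw
        by (simp add: sum_nonneg stage_cost_nonneg[OF wp])
      finally show ?thesis .
    qed
    then have lower: "a + b \<le> mpc_value P x \<theta>" unfolding o(1) b_def by simp
    show ?thesis
    \<comment> \<open>Far from the setpoint, the level \<open>Jbar\<close> alone gives the bound.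
      Near it, \<open>2 * a\<close> uses half of the radius \<open>c\<close> and leaves the other
      half for the shift of the setpoint.\<close>
    proof (cases "a \<le> c / 4")
      case False
      then have "1 \<le> 4 * a / c" using c by (simp add: field_simps)
      then have "mpc_value P x \<theta> \<le> Jbar * (4 * a / c)"
        using V mult_left_mono[of 1 "4 * a / c" Jbar] Jbar by simp
      also have "\<dots> = (4 * Jbar / c) * a" by simp
      also have "\<dots> \<le> K * a" unfolding K_def using C1 \<eta> ab by (intro mult_right_mono) auto
      finally show ?thesis unfolding a_def .
    next
      case True
      \<comment> \<open>Since the optimal output equals the target for every parameter, the optimal
        setpoint provides the second endpoint of the convex combination.\<close>
      obtain xd ud yd where rd: "rd \<theta> = (xd, ud, yd)" by (metis prod.collapse)
      have "(xd, ud, yd) \<in> setpoints P \<theta>"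
        using osp th unfolding optimal_setpoint_def is_arg_min_def rd[symmetric] by blast
      moreover have "yd = target P" using sc th rd unfolding setpoint_conditions_def by force
      ultimately have d: "(xd, ud, target P) \<in> setpoints P \<theta>" by simp
      define y where "y = (1 - \<eta>) *\<^sub>R ys + (1 - (1 - \<eta>)) *\<^sub>R target P"
      have s: "(gx y \<theta>, gu y \<theta>, y) \<in> setpoints P \<theta>"
        unfolding y_def using \<eta> by (intro conv[OF th o(3) d]) auto
      have y1: "ys - y = \<eta> *\<^sub>R (ys - target P)" and y2: "y - target P = (1 - \<eta>) *\<^sub>R (ys - target P)"
        unfolding y_def by (simp_all add: algebra_simps)
      have "(wnorm (wQ P) (xs - gx y \<theta>))\<^sup>2 + (wnorm (wR P) (gu ys \<theta> - gu y \<theta>))\<^sup>2 \<le> Lg * (\<eta>\<^sup>2 * b)"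
        using Lg[OF th th, of ys y] g[OF th o(3)]
        unfolding y1 wnorm_power2_scaleR[OF T] b_def by simp
      then have "(wnorm (wQ P) (xs - gx y \<theta>))\<^sup>2 \<le> Lg * (\<eta>\<^sup>2 * b)"
        using zero_le_power2[of "wnorm (wR P) (gu ys \<theta> - gu y \<theta>)"] by linarith
      moreover have "(wnorm (wQ P) (x - gx y \<theta>))\<^sup>2 \<le> 2 * a + 2 * (wnorm (wQ P) (xs - gx y \<theta>))\<^sup>2"
        using wnorm_power2_add_le[OF Q, of 1 "x - xs" "xs - gx y \<theta>"] unfolding a_def by simp
      ultimately have q: "(wnorm (wQ P) (x - gx y \<theta>))\<^sup>2 \<le> 2 * a + 2 * Lg * \<eta>\<^sup>2 * b" by simp
      have "2 * Lg * \<eta>\<^sup>2 * b \<le> 2 * Lg * \<eta>\<^sup>2 * Jbar"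
        using lower ab V Lg0 by (intro mult_left_mono) auto
      with q \<eta>2 True have qc: "(wnorm (wQ P) (x - gx y \<theta>))\<^sup>2 \<le> c" by linarith
      let ?q = "(wnorm (wQ P) (x - gx y \<theta>))\<^sup>2"
      have "rollout_cost P k x \<theta> (gx y \<theta>) (gu y \<theta>) \<le> C * ?q" for k
      proof -
        have "C * \<rho> ^ k * ?q \<le> C * 1 * ?q"
          using C \<rho> by (intro mult_right_mono mult_left_mono power_le_one) auto
        with roll[OF th s qc, of k] show ?thesis by simp
      qed
      note t = tracking_cost_feedback_le[OF tw this]
      let ?uu = "restrict (\<lambda>k. feedback P (rollout P k x \<theta> (gx y \<theta>) (gu y \<theta>)) \<theta> (gx y \<theta>) (gu y \<theta>)) {..<horizon P}"
      have "mpc_value P x \<theta> \<le> mpc_objective P x \<theta> (?uu, gx y \<theta>, gu y \<theta>, y)"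
        using s feedback_in_inputs[OF wp th setpointsD[OF wp s]]
        by (intro mpc_value_le[OF wp tw]) (auto simp: mpc_feasible_def)
      also have "\<dots> \<le> C1 * ?q + (1 - \<eta>)\<^sup>2 * b"
        using t unfolding mpc_objective.simps y2 wnorm_power2_scaleR[OF T] b_def C1_def by simp
      also have "\<dots> \<le> C1 * (2 * a + 2 * Lg * \<eta>\<^sup>2 * b) + (1 - \<eta>)\<^sup>2 * b"
        using mult_left_mono[OF q C1] by simp
      \<comment> \<open>The terms quadratic in \<eta> are grouped so that the first bound on \<eta>
        replaces them by \<eta>, leaving the factor \<open>1 - \<eta>\<close> on
        \<open>b\<close>.\<close>
      also have "\<dots> = 2 * C1 * a + (1 - 2 * \<eta> + \<eta> * (\<eta> * (2 * C1 * Lg + 1))) * b"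
        by (simp add: power2_eq_square algebra_simps)
      also have "\<dots> \<le> 2 * C1 * a + (1 - \<eta>) * b"
        using mult_left_mono[OF \<eta>1, of \<eta>] \<eta> ab by (intro add_left_mono mult_right_mono) auto
      finally have up: "mpc_value P x \<theta> \<le> 2 * C1 * a + (1 - \<eta>) * b" .
      \<comment> \<open>The optimal value is also at least \<open>a + b\<close>; subtracting leaves
        \<open>\<eta> * b\<close> on the side of the offset.\<close>
      with lower ab have "\<eta> * b \<le> 2 * C1 * a" by (simp add: algebra_simps)
      then have "b \<le> 2 * C1 / \<eta> * a" using \<eta> by (simp add: field_simps)
      moreover have "(1 - \<eta>) * b \<le> b" using \<eta> ab by (simp add: mult_left_le_one_le)
      moreover have "4 * Jbar / c * a \<ge> 0" using Jbar c ab by simp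
      moreover have "K * a = 2 * C1 * a + 2 * C1 / \<eta> * a + 4 * Jbar / c * a"
        unfolding K_def by (simp add: distrib_right)
      ultimately show ?thesis using up unfolding a_def[symmetric] by linarith
    qed
  qed
  with K show thesis by (rule that)
qed

section \<open>Contraction and invariance in closed loop\<close>

theorem theorem6:
  fixes P :: "('nx::finite, 'nu::finite, 'np::finite, 'nw::finite, 'ny::finite) mpc"
    and G :: "real^'nx \<Rightarrow> real^'nu \<Rightarrow> real^'nw \<Rightarrow> real^'np^'nx"
    and rd :: "real^'np \<Rightarrow> (real^'nx) \<times> (real^'nu) \<times> (real^'ny)"
    and uopt :: "real^'nx \<Rightarrow> real^'np \<Rightarrow> nat \<Rightarrow> real^'nu"
    and xsopt :: "real^'nx \<Rightarrow> real^'np \<Rightarrow> real^'nx"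
    and usopt :: "real^'nx \<Rightarrow> real^'np \<Rightarrow> real^'nu"
    and ysopt :: "real^'nx \<Rightarrow> real^'np \<Rightarrow> real^'ny"
    and \<pi> :: "real^'nx \<Rightarrow> real^'np \<Rightarrow> real^'nu"
    and Jbar :: real
  assumes "well_posed P"
    and "optimal_setpoint P rd"
    and "regular P"
    and "linearly_parametrized P G"
    and "locally_exp_stabilizable P"
    and "setpoint_conditions P rd"
    and "mpc_minimizer P (\<lambda>x \<theta>. (uopt x \<theta>, xsopt x \<theta>, usopt x \<theta>, ysopt x \<theta>))"
    and "\<And>x \<theta>. \<pi> x \<theta> = uopt x \<theta> 0"
    and "Jbar > 0" and "term_weight P \<ge> 1" and "term_steps P \<ge> 1" and "horizon P \<ge> 1"
    and "\<exists>\<alpha>>0. \<forall>(x, \<theta>)\<in>sublevel P Jbar.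
           mpc_value P (dyn P x (\<pi> x \<theta>) \<theta> 0) \<theta> - mpc_value P x \<theta>
             \<le> - \<alpha> * stage_cost P x (\<pi> x \<theta>) (xsopt x \<theta>) (usopt x \<theta>)"
  shows "\<exists>\<rho>V cV. 0 < \<rho>V \<and> \<rho>V < 1 \<and> cV > 0 \<and>
    (\<forall>(x :: nat \<Rightarrow> real^'nx) (xhat :: nat \<Rightarrow> real^'nx) (u :: nat \<Rightarrow> real^'nu)
      (\<theta> :: nat \<Rightarrow> real^'np) (\<theta>hat :: nat \<Rightarrow> real^'np)
      (v :: nat \<Rightarrow> real^'nx) (w :: nat \<Rightarrow> real^'nw)
      (wtilde :: nat \<Rightarrow> real^'nx) (xtilde :: nat \<Rightarrow> real^'nx).
       (xhat 0, \<theta>hat 0) \<in> sublevel P Jbar \<and>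
       (\<forall>k. \<theta>hat k \<in> params P) \<and>
       (\<forall>k. \<theta> k \<in> params P) \<and>
       (\<forall>k. x (Suc k) = dyn P (x k) (u k) (\<theta> k) (w k)) \<and>
       (\<forall>k. u k = \<pi> (xhat k) (\<theta>hat k)) \<and>
       (\<forall>k. xhat k = x k + v k) \<and>
       (\<forall>k. xtilde k = G (xhat k) (u k) 0 *v (\<theta> k - \<theta>hat k)) \<and>
       (\<forall>k. wtilde k = xhat (Suc k) - dyn P (xhat k) (u k) (\<theta> k) 0) \<and>
       (\<forall>k. (norm (wtilde k + xtilde k))\<^sup>2 + (norm (\<theta>hat (Suc k) - \<theta>hat k))\<^sup>2
              \<le> Jbar / (cV * (1 - \<rho>V)))
       \<longrightarrow>
       (\<forall>k. (xhat k, \<theta>hat k) \<in> sublevel P Jbar \<and>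
            mpc_value P (xhat (Suc k)) (\<theta>hat (Suc k))
              \<le> \<rho>V * mpc_value P (xhat k) (\<theta>hat k) +
                cV * ((norm (wtilde k + xtilde k))\<^sup>2 + (norm (\<theta>hat (Suc k) - \<theta>hat k))\<^sup>2)))"
proof -
  note wp = assms(1) and osp = assms(2) and reg = assms(3) and lin = assms(4) and les = assms(5)
    and sc = assms(6) and opt = assms(7) and pi = assms(8) and Jbar = assms(9)
  have tw: "term_weight P \<ge> 0" using assms(10) by simp
  let ?V = "mpc_value P"
  obtain \<alpha> where \<alpha>: "\<alpha> > 0" and desc: "\<And>x \<theta>. (x, \<theta>) \<in> sublevel P Jbar \<Longrightarrow>
      ?V (dyn P x (\<pi> x \<theta>) \<theta> 0) \<theta> - ?V x \<theta> \<le> - \<alpha> * stage_cost P x (\<pi> x \<theta>) (xsopt x \<theta>) (usopt x \<theta>)"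
    using assms(13) by blast
  obtain C where C: "C > 0" and VC: "\<And>x \<theta> uu xs us ys. \<lbrakk>(x, \<theta>) \<in> sublevel P Jbar;
      (uopt x \<theta>, xsopt x \<theta>, usopt x \<theta>, ysopt x \<theta>) = (uu, xs, us, ys)\<rbrakk> \<Longrightarrow>
      ?V x \<theta> \<le> C * (wnorm (wQ P) (x - xs))\<^sup>2"
    using that by (rule mpc_value_le_state_error[OF wp osp les sc opt tw assms(12) Jbar])
  \<comment> \<open>The direct rate \<open>1 - \<alpha> / C\<close> could be nonpositive. Weakening
    the cost bound from \<open>C\<close> to \<open>C + \<alpha>\<close> gives a rate strictly
    between 0 and 1.\<close>
  define \<rho> where "\<rho> = C / (C + \<alpha>)"
  have \<rho>: "0 < \<rho>" "\<rho> < 1" using C \<alpha> by (simp_all add: \<rho>_def)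
  have nominal: "?V (dyn P x (\<pi> x \<theta>) \<theta> 0) \<theta> \<le> \<rho> * ?V x \<theta>" if sub: "(x, \<theta>) \<in> sublevel P Jbar" for x \<theta>
  proof -
    have th: "\<theta> \<in> params P" using sub by (simp add: sublevel_def)
    let ?l = "stage_cost P x (\<pi> x \<theta>) (xsopt x \<theta>) (usopt x \<theta>)"
    have "?V x \<theta> \<le> C * (wnorm (wQ P) (x - xsopt x \<theta>))\<^sup>2" by (rule VC[OF sub refl])
    also have "\<dots> \<le> C * ?l" using C stage_cost_ge[OF wp] by (intro mult_left_mono) auto
    finally have "?V x \<theta> \<le> C * ?l" .
    then have "?V x \<theta> \<le> (C + \<alpha>) * ?l"
      using \<alpha> stage_cost_nonneg[OF wp] by (simp add: distrib_right add_increasing2)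
    then have "?V x \<theta> / (C + \<alpha>) \<le> ?l" using C \<alpha> by (simp add: pos_divide_le_eq mult.commute)
    then have "\<alpha> * (?V x \<theta> / (C + \<alpha>)) \<le> \<alpha> * ?l" using \<alpha> by (intro mult_left_mono) auto
    then have "\<alpha> / (C + \<alpha>) * ?V x \<theta> \<le> \<alpha> * ?l" by simp
    moreover have "\<rho> * ?V x \<theta> = ?V x \<theta> - \<alpha> / (C + \<alpha>) * ?V x \<theta>"
      using C \<alpha> unfolding \<rho>_def by (simp add: field_simps)
    ultimately show ?thesis using desc[OF sub] by linarith
  qed
  \<comment> \<open>Chosen so that \<open>(1 + e) * \<rho>\<close> is the midpoint of \<rho> and
    1.\<close>
  define e where "e = (1 - \<rho>) / (2 * \<rho>)"
  have e: "e > 0" using \<rho> by (simp add: e_def)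
  obtain K where K: "K \<ge> 0" and pert: "\<And>z d \<theta> \<theta>'. \<lbrakk>\<theta> \<in> params P; \<theta>' \<in> params P\<rbrakk> \<Longrightarrow> ?V (z + d) \<theta>'
      \<le> (1 + e) * ?V z \<theta> + K * ((norm d)\<^sup>2 + (norm (\<theta>' - \<theta>))\<^sup>2)"
    using that by (rule mpc_value_perturb[OF wp reg les sc opt e tw])
  define \<rho>V where "\<rho>V = (1 + \<rho>) / 2"
  have \<rho>V: "0 < \<rho>V" "\<rho>V < 1" using \<rho> by (simp_all add: \<rho>V_def)
  have e\<rho>: "(1 + e) * \<rho> = \<rho>V" using \<rho> by (simp add: e_def \<rho>V_def field_simps)
  text \<open>
    The prescribed disturbance bound \<open>Jbar / (cV * (1 - \<rho>V))\<close> preserves the sublevel set only if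
    \<open>cV\<close> exceeds the gain \<open>K\<close> by the factor \<open>1 / (1 - \<rho>V)\<^sup>2\<close>.
  \<close>
  define cV where "cV = (K + 1) / (1 - \<rho>V)\<^sup>2"
  \<comment> \<open>With \<open>K + 1\<close> in place of \<open>K\<close>, positivity holds even if
    \<open>K\<close> is 0.\<close>
  have cV: "cV > 0" using K \<rho>V by (simp add: cV_def)
  have "(1 - \<rho>V)\<^sup>2 \<le> 1" using \<rho>V by (intro power_le_one) auto
  then have "(K + 1) * (1 - \<rho>V)\<^sup>2 \<le> (K + 1) * 1" using K by (intro mult_left_mono) auto
  then have "K + 1 \<le> cV" using \<rho>V unfolding cV_def by (simp add: pos_le_divide_eq)
  then have KcV: "K \<le> cV" by simp
  have bound: "Jbar / (cV * (1 - \<rho>V)) = (1 - \<rho>V) * Jbar / (K + 1)"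
    using \<rho>V K unfolding cV_def by (simp add: power2_eq_square)
  have step: "?V (dyn P x (\<pi> x \<theta>) \<theta> 0 + d) \<theta>' \<le> \<rho>V * ?V x \<theta> + K * ((norm d)\<^sup>2 + (norm (\<theta>' - \<theta>))\<^sup>2)"
    if sub: "(x, \<theta>) \<in> sublevel P Jbar" and th': "\<theta>' \<in> params P" for x d \<theta> \<theta>'
  proof -
    have th: "\<theta> \<in> params P" using sub by (simp add: sublevel_def)
    have "(1 + e) * ?V (dyn P x (\<pi> x \<theta>) \<theta> 0) \<theta> \<le> (1 + e) * (\<rho> * ?V x \<theta>)"
      using e by (intro mult_left_mono nominal sub) auto
    then show ?thesis using pert[OF th th', of "dyn P x (\<pi> x \<theta>) \<theta> 0" d] by (simp add: e\<rho>[symmetric])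
  qed
  show ?thesis
  proof (rule exI[of _ \<rho>V], rule exI[of _ cV], intro conjI \<rho>V cV allI impI; elim conjE)
    fix x xhat :: "nat \<Rightarrow> real^'nx" and u :: "nat \<Rightarrow> real^'nu" and \<theta> \<theta>hat :: "nat \<Rightarrow> real^'np"
      and v :: "nat \<Rightarrow> real^'nx" and w :: "nat \<Rightarrow> real^'nw" and wtilde xtilde :: "nat \<Rightarrow> real^'nx" and k
    assume init: "(xhat 0, \<theta>hat 0) \<in> sublevel P Jbar"
      and thh: "\<forall>k. \<theta>hat k \<in> params P"
      and u: "\<forall>k. u k = \<pi> (xhat k) (\<theta>hat k)"
      and xt: "\<forall>k. xtilde k = G (xhat k) (u k) 0 *v (\<theta> k - \<theta>hat k)"
      and wt: "\<forall>k. wtilde k = xhat (Suc k) - dyn P (xhat k) (u k) (\<theta> k) 0"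
      and small: "\<forall>k. (norm (wtilde k + xtilde k))\<^sup>2 + (norm (\<theta>hat (Suc k) - \<theta>hat k))\<^sup>2
              \<le> Jbar / (cV * (1 - \<rho>V))"
    let ?E = "\<lambda>k. (norm (wtilde k + xtilde k))\<^sup>2 + (norm (\<theta>hat (Suc k) - \<theta>hat k))\<^sup>2"
    \<comment> \<open>By linearity in the parameter, \<open>xtilde k\<close> is the difference
      between the models with true and estimated parameter. So \<open>wtilde k + xtilde k\<close> is
      exactly the one-step prediction error of the model used by the controller.\<close>
    have next_state: "xhat (Suc k) = dyn P (xhat k) (\<pi> (xhat k) (\<theta>hat k)) (\<theta>hat k) 0 + (wtilde k + xtilde k)" for k
    proof -
      have f: "dyn P (xhat k) (u k) \<theta>' 0 = dyn P (xhat k) (u k) 0 0 + G (xhat k) (u k) 0 *v \<theta>'" for \<theta>'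
        using lin unfolding linearly_parametrized_def by blast
      have "dyn P (xhat k) (u k) (\<theta>hat k) 0 + (wtilde k + xtilde k) = xhat (Suc k)"
        unfolding wt[rule_format, of k] xt[rule_format, of k] f[of "\<theta> k"] f[of "\<theta>hat k"]
        by (simp add: matrix_vector_mult_diff_distrib)
      then show ?thesis using u by simp
    qed
    have decay: "?V (xhat (Suc k)) (\<theta>hat (Suc k)) \<le> \<rho>V * ?V (xhat k) (\<theta>hat k) + K * ?E k"
      if "(xhat k, \<theta>hat k) \<in> sublevel P Jbar" for k
      unfolding next_state by (rule step[OF that thh[rule_format]])
    have inv: "(xhat k, \<theta>hat k) \<in> sublevel P Jbar" for k
    proof (induction k)
      case (Suc k)
      have "\<rho>V * ?V (xhat k) (\<theta>hat k) \<le> \<rho>V * Jbar"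
        using Suc \<rho>V by (intro mult_left_mono) (auto simp: sublevel_def)
      \<comment> \<open>Invariance is proved with the gain \<open>K\<close>. With \<open>cV\<close>
        the disturbance bound would only give \<open>Jbar / (1 - \<rho>V)\<close>, which exceeds the
        available margin \<open>(1 - \<rho>V) * Jbar\<close>.\<close>
      moreover have "K * ?E k \<le> (1 - \<rho>V) * Jbar"
      proof -
        have "K * ?E k \<le> (K + 1) * ?E k" by (intro mult_right_mono) auto
        also have "\<dots> \<le> (K + 1) * ((1 - \<rho>V) * Jbar / (K + 1))"
          using small K unfolding bound by (intro mult_left_mono) auto
        also have "\<dots> = (1 - \<rho>V) * Jbar" using K by simp
        finally show ?thesis .
      qed
      ultimately have "?V (xhat (Suc k)) (\<theta>hat (Suc k)) \<le> \<rho>V * Jbar + (1 - \<rho>V) * Jbar"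
        using decay[OF Suc] by linarith
      then show ?case using thh by (simp add: sublevel_def algebra_simps)
    qed (rule init)
    show "(xhat k, \<theta>hat k) \<in> sublevel P Jbar" by (rule inv)
    have "K * ?E k \<le> cV * ?E k" using KcV by (intro mult_right_mono) auto
    with decay[OF inv, of k]
    show "?V (xhat (Suc k)) (\<theta>hat (Suc k)) \<le> \<rho>V * ?V (xhat k) (\<theta>hat k) + cV * ?E k" by linarith
  qed
qed

end
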